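(* Let $p=0.05$, $q=0.4$, let $\mathcal N_1(\rho)=q\rho+(1-q)\sigma_z\rho\sigma_z$ be the qubit dephasing channel and $\mathcal N_2(\rho)=(1-p)\rho+p\,(\operatorname{Tr}\rho)\,I/2$ the qubit depolarizing channel, and let $f(\rho)=-D(\sqrt{\rho}\,\Gamma^{\mathcal N_1}\sqrt{\rho}\,\|\,\sqrt{\rho}\,\Gamma^{\mathcal N_2}\sqrt{\rho})$. Let $H\in\{\sigma_x,\sigma_y,\sigma_z\}$ and let $E\in\mathbb R$ be such that the feasible set $\mathcal M=\{\rho:\rho\text{ a qubit density operator},\ \operatorname{Tr}\rho H=E\}$ is nonempty. Then $\hat\rho=\frac12(I+EH)$ is a global minimizer of $f$ over $\mathcal M$.
   Context: $\mathcal H_A=\mathcal H_B=\mathbb C^2$; $\sigma_x,\sigma_y,\sigma_z$ are the Pauli matrices. For a channel $\mathcal N$ from $A$ to $B$, the (unnormalized) Choi matrix is $\Gamma^{\mathcal N}=\sum_{i,j}|i\rangle\langle j|_A\otimes\mathcal N(|i\rangle\langle j|)_B$; $\sqrt\rho$ acts as $\sqrt\rho\otimes I_B$. $D(\sigma\|\tau)=\operatorname{Tr}\,\sigma(\log\sigma-\log\tau)$ is the quantum relative entropy of positive semidefinite operators, with logarithms taken on supports (here the support of the first argument is always contained in that of the second). *)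

theory Defs
  imports "HOL-Analysis.Analysis"
begin

section \<open>Complex matrices\<close>

definition adjoint_mat :: "complex^'n^'m \<Rightarrow> complex^'m^'n" where
  "adjoint_mat A = (\<chi> i j. cnj (A $ j $ i))"

definition unitary_mat :: "complex^'n^'n \<Rightarrow> bool" where
  "unitary_mat U \<longleftrightarrow> adjoint_mat U ** U = mat 1 \<and> U ** adjoint_mat U = mat 1"

definition real_diag :: "('n \<Rightarrow> real) \<Rightarrow> complex^'n^'n" where
  "real_diag d = (\<chi> i j. if i = j then complex_of_real (d i) else 0)"

definition pos_semidef :: "complex^'n^'n \<Rightarrow> bool" where
  "pos_semidef A \<longleftrightarrow>
     adjoint_mat A = A \<and> (\<forall>v. 0 \<le> Re (\<Sum>i\<in>UNIV. cnj (v $ i) * (A *v v) $ i))"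

definition kron :: "complex^'a^'a \<Rightarrow> complex^'b^'b \<Rightarrow> complex^('a \<times> 'b)^('a \<times> 'b)" where
  "kron A B = (\<chi> r c. A $ fst r $ fst c * B $ snd r $ snd c)"

definition mat_unit :: "'n \<Rightarrow> 'n \<Rightarrow> complex^'n^'n" where
  "mat_unit i j = (\<chi> r c. if r = i \<and> c = j then 1 else 0)"

subsection \<open>Functional calculus for Hermitian matrices\<close>

text \<open>
  If \<open>A = U diag(d) U*\<close> with \<open>U\<close> unitary and \<open>d\<close> real, then \<open>f(A) = U diag(f(d)) U*\<close>.
  By lemma \<open>herm_fun_eq\<close> below this does not depend on the chosen diagonalization.
\<close>

definition herm_fun :: "(real \<Rightarrow> real) \<Rightarrow> complex^'n^'n \<Rightarrow> complex^'n^'n" where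
  "herm_fun f A =
     (THE X. \<exists>U d. unitary_mat U \<and> A = U ** real_diag d ** adjoint_mat U \<and>
                   X = U ** real_diag (\<lambda>i. f (d i)) ** adjoint_mat U)"

lemma matrix_mult_real_diag_right: "(A ** real_diag d) $ i $ j = A $ i $ j * complex_of_real (d j)"
  by (simp add: matrix_matrix_mult_def real_diag_def mult_delta_right)

lemma matrix_mult_real_diag_left: "(real_diag d ** A) $ i $ j = complex_of_real (d i) * A $ i $ j"
  by (simp add: matrix_matrix_mult_def real_diag_def mult_delta_left)

lemma diagonalization_fun_unique:
  fixes U V :: "complex^'n^'n"
  assumes U: "unitary_mat U" and V: "unitary_mat V"
    and eq: "U ** real_diag d ** adjoint_mat U = V ** real_diag e ** adjoint_mat V"
  shows "U ** real_diag (\<lambda>i. f (d i)) ** adjoint_mat U =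
         V ** real_diag (\<lambda>i. f (e i)) ** adjoint_mat V"
proof -
  define W where "W = adjoint_mat V ** U"
  have UU: "adjoint_mat U ** U = mat 1" "U ** adjoint_mat U = mat 1"
    and VV: "adjoint_mat V ** V = mat 1" "V ** adjoint_mat V = mat 1"
    using U V by (auto simp: unitary_mat_def)
  have "W ** real_diag d = adjoint_mat V ** (U ** real_diag d ** adjoint_mat U) ** U"
    by (simp add: W_def UU matrix_mul_assoc [symmetric])
  also have "\<dots> = (adjoint_mat V ** V) ** real_diag e ** adjoint_mat V ** U"
    unfolding eq by (simp add: matrix_mul_assoc)
  finally have "W ** real_diag d = real_diag e ** W"
    by (simp add: VV W_def matrix_mul_assoc)
  then have *: "W $ i $ j * complex_of_real (d j) = complex_of_real (e i) * W $ i $ j" for i j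
    by (metis matrix_mult_real_diag_left matrix_mult_real_diag_right)
  have "W $ i $ j * complex_of_real (f (d j)) = complex_of_real (f (e i)) * W $ i $ j" for i j
    using * [of i j] by (cases "W $ i $ j = 0") (auto simp: mult.commute)
  then have W: "W ** real_diag (\<lambda>i. f (d i)) = real_diag (\<lambda>i. f (e i)) ** W"
    by (simp add: vec_eq_iff matrix_mult_real_diag_left matrix_mult_real_diag_right)
  have "U ** real_diag (\<lambda>i. f (d i)) ** adjoint_mat U =
        (V ** adjoint_mat V) ** U ** real_diag (\<lambda>i. f (d i)) ** adjoint_mat U"
    by (simp add: VV)
  also have "\<dots> = V ** (W ** real_diag (\<lambda>i. f (d i))) ** adjoint_mat U"
    by (simp add: W_def matrix_mul_assoc)
  also have "\<dots> = V ** real_diag (\<lambda>i. f (e i)) ** adjoint_mat V ** (U ** adjoint_mat U)"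
    unfolding W by (simp add: W_def matrix_mul_assoc)
  finally show ?thesis
    by (simp add: UU)
qed

lemma herm_fun_eq:
  assumes "unitary_mat U"
  shows "herm_fun f (U ** real_diag d ** adjoint_mat U) =
         U ** real_diag (\<lambda>i. f (d i)) ** adjoint_mat U"
  unfolding herm_fun_def
proof (rule the_equality)
  fix X
  assume "\<exists>V e. unitary_mat V \<and> U ** real_diag d ** adjoint_mat U = V ** real_diag e ** adjoint_mat V \<and>
                X = V ** real_diag (\<lambda>i. f (e i)) ** adjoint_mat V"
  then obtain V e where V: "unitary_mat V"
      "U ** real_diag d ** adjoint_mat U = V ** real_diag e ** adjoint_mat V"
      "X = V ** real_diag (\<lambda>i. f (e i)) ** adjoint_mat V"
    by iprover
  show "X = U ** real_diag (\<lambda>i. f (d i)) ** adjoint_mat U"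
    unfolding V(3) by (rule diagonalization_fun_unique [OF assms V(1,2), symmetric])
qed (rule exI [of _ U], rule exI [of _ d], simp add: assms)

definition sqrt_mat :: "complex^'n^'n \<Rightarrow> complex^'n^'n" where
  "sqrt_mat = herm_fun sqrt"

text \<open>Logarithm on the support: it vanishes on the kernel.\<close>

definition log_mat :: "complex^'n^'n \<Rightarrow> complex^'n^'n" where
  "log_mat = herm_fun (\<lambda>x. if x = 0 then 0 else ln x)"

text \<open>
  For Hermitian arguments the trace below is real.  The formula is the quantum relative entropy
  when the support of \<open>S\<close> is contained in that of \<open>T\<close>.
\<close>

definition rel_entropy :: "complex^'n^'n \<Rightarrow> complex^'n^'n \<Rightarrow> real" where
  "rel_entropy S T = Re (trace (S ** (log_mat S - log_mat T)))"

section \<open>Qubit channels\<close>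

text \<open>The indices \<open>1\<close> and \<open>2\<close> stand for the basis vectors \<open>|0\<rangle>\<close> and \<open>|1\<rangle>\<close>.\<close>

type_synonym qmat = "complex^2^2"

definition sigma_x :: qmat where
  "sigma_x = vector [vector [0, 1], vector [1, 0]]"

definition sigma_y :: qmat where
  "sigma_y = vector [vector [0, - \<i>], vector [\<i>, 0]]"

definition sigma_z :: qmat where
  "sigma_z = vector [vector [1, 0], vector [0, - 1]]"

definition density_op :: "complex^'n^'n \<Rightarrow> bool" where
  "density_op \<rho> \<longleftrightarrow> pos_semidef \<rho> \<and> trace \<rho> = 1"

definition dephasing :: "real \<Rightarrow> qmat \<Rightarrow> qmat" where
  "dephasing q \<rho> = q *\<^sub>R \<rho> + (1 - q) *\<^sub>R (sigma_z ** \<rho> ** sigma_z)"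

definition depolarizing :: "real \<Rightarrow> qmat \<Rightarrow> qmat" where
  "depolarizing p \<rho> = (1 - p) *\<^sub>R \<rho> + p *\<^sub>R mat (trace \<rho> / 2)"

definition choi :: "(complex^'a^'a \<Rightarrow> complex^'b^'b) \<Rightarrow> complex^('a \<times> 'b)^('a \<times> 'b)" where
  "choi N = (\<Sum>i\<in>UNIV. \<Sum>j\<in>UNIV. kron (mat_unit i j) (N (mat_unit i j)))"

definition choi_sandwich ::
    "(complex^'a^'a \<Rightarrow> complex^'b^'b) \<Rightarrow> complex^'a^'a \<Rightarrow> complex^('a \<times> 'b)^('a \<times> 'b)" where
  "choi_sandwich N \<rho> =
     kron (sqrt_mat \<rho>) (mat 1) ** choi N ** kron (sqrt_mat \<rho>) (mat 1)"

definition neg_channel_rel_entropy ::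
    "(complex^'a^'a \<Rightarrow> complex^'b^'b) \<Rightarrow> (complex^'a^'a \<Rightarrow> complex^'b^'b) \<Rightarrow>
     complex^'a^'a \<Rightarrow> real" where
  "neg_channel_rel_entropy N1 N2 \<rho> =
     - rel_entropy (choi_sandwich N1 \<rho>) (choi_sandwich N2 \<rho>)"

definition feasible :: "complex^'n^'n \<Rightarrow> real \<Rightarrow> (complex^'n^'n) set" where
  "feasible H E = {\<rho>. density_op \<rho> \<and> trace (\<rho> ** H) = complex_of_real E}"

end

(* Conjugation by H preserves f and averages every feasible state to the candidate, so it suffices
   that averaging does not decrease the relative entropy. A two-outcome measurement turns the two
   channel outputs at the averaged state, with probability 1/2 for each outcome, into those at the
   original state, so the inequality is an instance of the monotonicity of relative entropy.
   Monotonicity holds for each resolvent form <S, (L_T + x R_S)^-1 S>, being a supremum of functions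
   linear in (S, T), and passes to relative entropy by integration over x. *)
theory Submission
  imports Defs "HOL-Real_Asymp.Real_Asymp"
begin

section \<open>Frobenius inner product\<close>

text \<open>The obstacle is that \<open>choi_sandwich N \<rho>\<close> is not linear in \<rho>: the
  sandwich at an averaged state is not the average of the sandwiches, so convexity properties of
  relative entropy do not apply directly. The sandwich is, however, the channel output for a
  purification of \<rho> whose reference system is A. Measuring the reference steers a purification
  of the average to one of \<rho> or of its conjugate under H, and that is where the two outcomes
  come from. The measurement divides by the square root of the average, so the average has to be
  invertible. The candidate (1 + E H) / 2 is singular exactly when E^2 = 1; that boundary is treated
  apart, because every feasible state then equals the candidate. The two channels enter through
  positivity of their Choi matrices, definiteness of the second one, which settles all questions of
  support, and commutation with H \<otimes> H. No integral is evaluated: a primitive in x is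
  compared at 0 and at infinity.\<close>

lemma adjoint_mat_nth [simp]: "adjoint_mat A $ i $ j = cnj (A $ j $ i)"
  by (simp add: adjoint_mat_def)

lemma adjoint_adjoint_mat [simp]: "adjoint_mat (adjoint_mat A) = A"
  by (simp add: vec_eq_iff)

lemma adjoint_mat_mult: "adjoint_mat (A ** B) = adjoint_mat B ** adjoint_mat A"
  by (simp add: vec_eq_iff matrix_matrix_mult_def mult.commute)

lemma adjoint_mat_add: "adjoint_mat (A + B) = adjoint_mat A + adjoint_mat B"
  by (simp add: vec_eq_iff)

lemma adjoint_mat_diff: "adjoint_mat (A - B) = adjoint_mat A - adjoint_mat B"
  by (simp add: vec_eq_iff)

lemma adjoint_mat_scaleR: "adjoint_mat (c *\<^sub>R A) = c *\<^sub>R adjoint_mat A"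
  by (simp add: vec_eq_iff)

lemma adjoint_mat_1 [simp]: "adjoint_mat (mat 1) = mat 1"
  by (auto simp: vec_eq_iff mat_def)

lemma adjoint_real_diag [simp]: "adjoint_mat (real_diag d) = real_diag d"
  by (auto simp: vec_eq_iff real_diag_def)

lemma matrix_mult_scaleR_left: "(c *\<^sub>R A) ** (B :: complex^'n^'m) = c *\<^sub>R (A ** B)"
  by (simp add: vec_eq_iff matrix_matrix_mult_def scaleR_sum_right)

lemma matrix_mult_scaleR_right: "A ** (c *\<^sub>R B) = c *\<^sub>R (A ** (B :: complex^'n^'m))"
  by (simp add: vec_eq_iff matrix_matrix_mult_def scaleR_sum_right)

lemma matrix_mult_diff_left: "(A - B) ** C = A ** C - B ** (C :: complex^'n^'m)"
  by (simp add: vec_eq_iff matrix_matrix_mult_def left_diff_distrib sum_subtractf)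

lemma matrix_mult_diff_right: "A ** (B - C) = A ** B - A ** (C :: complex^'n^'m)"
  by (simp add: vec_eq_iff matrix_matrix_mult_def right_diff_distrib sum_subtractf)

lemma matrix_mult_add_left: "(A + B) ** C = A ** C + B ** (C :: complex^'n^'m)"
  by (simp add: vec_eq_iff matrix_matrix_mult_def distrib_right sum.distrib)

lemma matrix_mult_sum_right: "B ** sum f I = (\<Sum>k\<in>I. B ** (f k :: complex^'n^'m))"
  by (induction I rule: infinite_finite_induct) (simp_all add: matrix_add_ldistrib)

lemma inner_complex_mult_left: "inner (a * b) c = inner b (cnj a * c)"
  by (simp add: inner_complex_def algebra_simps)

lemma inner_matrix_mult_left: "(A ** B) \<bullet> C = B \<bullet> (adjoint_mat A ** C)"
proof -
  have "(A ** B) \<bullet> C = (\<Sum>i\<in>UNIV. \<Sum>j\<in>UNIV. \<Sum>k\<in>UNIV. (B $ k $ j) \<bullet> (cnj (A $ i $ k) * C $ i $ j))"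
    by (simp add: inner_vec_def matrix_matrix_mult_def inner_sum_left inner_complex_mult_left)
  also have "\<dots> = (\<Sum>i\<in>UNIV. \<Sum>k\<in>UNIV. \<Sum>j\<in>UNIV. (B $ k $ j) \<bullet> (cnj (A $ i $ k) * C $ i $ j))"
    by (intro sum.cong refl sum.swap)
  also have "\<dots> = (\<Sum>k\<in>UNIV. \<Sum>i\<in>UNIV. \<Sum>j\<in>UNIV. (B $ k $ j) \<bullet> (cnj (A $ i $ k) * C $ i $ j))"
    by (rule sum.swap)
  also have "\<dots> = (\<Sum>k\<in>UNIV. \<Sum>j\<in>UNIV. \<Sum>i\<in>UNIV. (B $ k $ j) \<bullet> (cnj (A $ i $ k) * C $ i $ j))"
    by (intro sum.cong refl sum.swap)
  also have "\<dots> = B \<bullet> (adjoint_mat A ** C)"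
    by (simp add: inner_vec_def matrix_matrix_mult_def inner_sum_right)
  finally show ?thesis .
qed

lemma inner_adjoint_mat: "adjoint_mat A \<bullet> adjoint_mat B = A \<bullet> B"
proof -
  have "adjoint_mat A \<bullet> adjoint_mat B = (\<Sum>i\<in>UNIV. \<Sum>j\<in>UNIV. (A $ j $ i) \<bullet> (B $ j $ i))"
    by (simp add: inner_vec_def inner_complex_def)
  also have "\<dots> = A \<bullet> B"
    unfolding inner_vec_def by (rule sum.swap)
  finally show ?thesis .
qed

lemma inner_matrix_mult_right: "(A ** B) \<bullet> C = A \<bullet> (C ** adjoint_mat B)"
proof -
  have "(A ** B) \<bullet> C = (adjoint_mat B ** adjoint_mat A) \<bullet> adjoint_mat C"
    by (simp flip: adjoint_mat_mult add: inner_adjoint_mat)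
  also have "\<dots> = adjoint_mat A \<bullet> adjoint_mat (C ** adjoint_mat B)"
    by (simp add: inner_matrix_mult_left adjoint_mat_mult)
  finally show ?thesis
    by (simp add: inner_adjoint_mat)
qed

text \<open>The real inner product \<bullet> of complex matrices is the real part of the Frobenius
  product Tr A* B; in this form the trace in \<open>rel_entropy\<close> can be rearranged by moving
  factors across \<bullet>.\<close>

lemma trace_mult_eq_inner: "Re (trace (A ** B)) = adjoint_mat A \<bullet> B"
proof -
  have "adjoint_mat A \<bullet> B = (\<Sum>i\<in>UNIV. \<Sum>k\<in>UNIV. Re (A $ k $ i * B $ i $ k))"
    by (simp add: inner_vec_def inner_complex_def)
  also have "\<dots> = (\<Sum>k\<in>UNIV. \<Sum>i\<in>UNIV. Re (A $ k $ i * B $ i $ k))"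
    by (rule sum.swap)
  finally show ?thesis
    by (simp add: trace_def matrix_matrix_mult_def)
qed

lemma trace_eq_inner: "Re (trace A) = A \<bullet> mat 1"
  using trace_mult_eq_inner [of "mat 1" A] by (simp add: inner_commute)

lemma inner_matrix_vector_mult: "(A *v x) \<bullet> y = x \<bullet> (adjoint_mat A *v y)"
proof -
  have "(A *v x) \<bullet> y = (\<Sum>i\<in>UNIV. \<Sum>k\<in>UNIV. (x $ k) \<bullet> (cnj (A $ i $ k) * y $ i))"
    by (simp add: inner_vec_def matrix_vector_mult_def inner_sum_left inner_complex_mult_left)
  also have "\<dots> = (\<Sum>k\<in>UNIV. \<Sum>i\<in>UNIV. (x $ k) \<bullet> (cnj (A $ i $ k) * y $ i))"
    by (rule sum.swap)
  finally show ?thesis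
    by (simp add: inner_vec_def matrix_vector_mult_def inner_sum_right)
qed

section \<open>Positive semidefinite matrices\<close>

lemma pos_semidef_altdef:
  "pos_semidef A \<longleftrightarrow> adjoint_mat A = A \<and> (\<forall>v. 0 \<le> v \<bullet> (A *v v))"
  by (simp add: pos_semidef_def inner_vec_def inner_complex_def)

lemma matrix_vector_mult_scaleR_right: "A *v (c *\<^sub>R x) = c *\<^sub>R (A *v (x :: complex^'n))"
  by (simp add: vec_eq_iff matrix_vector_mult_def scaleR_sum_right)

lemma matrix_vector_mult_scaleR_left: "(c *\<^sub>R A) *v x = c *\<^sub>R (A *v (x :: complex^'n))"
  by (simp add: vec_eq_iff matrix_vector_mult_def scaleR_sum_right)

lemma pos_semidef_conj:
  assumes "pos_semidef A"
  shows "pos_semidef (K ** A ** adjoint_mat K)"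
proof -
  have "v \<bullet> ((K ** A ** adjoint_mat K) *v v) = (adjoint_mat K *v v) \<bullet> (A *v (adjoint_mat K *v v))" for v
    by (simp add: inner_matrix_vector_mult flip: matrix_vector_mul_assoc)
  with assms show ?thesis
    by (simp add: pos_semidef_altdef adjoint_mat_mult matrix_mul_assoc)
qed

lemma pos_semidef_scaleR:
  assumes "pos_semidef A" "0 \<le> c"
  shows "pos_semidef (c *\<^sub>R A)"
  using assms by (simp add: pos_semidef_altdef adjoint_mat_scaleR matrix_vector_mult_scaleR_left)

lemma pos_semidef_add:
  assumes "pos_semidef A" "pos_semidef B"
  shows "pos_semidef (A + B)"
  using assms
  by (simp add: pos_semidef_altdef adjoint_mat_add matrix_vector_mult_add_rdistrib inner_add_right)

section \<open>Spectral theorem\<close>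

text \<open>A maximiser v of the quadratic form on the unit sphere of \<open>W\<close> is an
  eigenvector: its residual \<open>u\<close> again lies in \<open>W\<close>, and if it were nonzero,
  moving from v along \<open>u\<close> would increase the Rayleigh quotient to first order.\<close>

lemma hermitian_eigenvector_in_subspace:
  fixes A :: "complex^'n^'n"
  assumes A: "adjoint_mat A = A" and W: "subspace W" "\<And>w. w \<in> W \<Longrightarrow> A *v w \<in> W"
    and x: "x \<in> W" "x \<noteq> 0"
  obtains v \<mu> where "v \<in> W" "norm v = 1" "A *v v = \<mu> *\<^sub>R v"
proof -
  define S where "S = sphere 0 1 \<inter> W"
  have "compact S"
    unfolding S_def by (intro compact_Int_closed compact_sphere closed_subspace W)
  moreover have "(1 / norm x) *\<^sub>R x \<in> S"
    using x by (simp add: S_def subspace_scale W)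
  moreover have "continuous_on S (\<lambda>v. v \<bullet> (A *v v))"
    unfolding matrix_vector_mult_def by (intro continuous_intros)
  ultimately obtain v where v: "v \<in> S" and max: "\<And>w. w \<in> S \<Longrightarrow> w \<bullet> (A *v w) \<le> v \<bullet> (A *v v)"
    using continuous_attains_sup [of S "\<lambda>v. v \<bullet> (A *v v)"] by (metis empty_iff)
  define \<mu> where "\<mu> = v \<bullet> (A *v v)"
  have bound: "w \<bullet> (A *v w) \<le> \<mu> * (w \<bullet> w)" if "w \<in> W" for w
  proof (cases "w = 0")
    case False
    with that have "(1 / norm w) *\<^sub>R w \<in> S"
      by (simp add: S_def subspace_scale W)
    from max [OF this] have "w \<bullet> (A *v w) / (norm w * norm w) \<le> \<mu>"
      by (simp add: matrix_vector_mult_scaleR_right \<mu>_def)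
    with False show ?thesis
      by (simp add: divide_simps power2_norm_eq_inner flip: power2_eq_square)
  qed auto
  have vW: "v \<in> W" and norm_v: "norm v = 1"
    using v by (auto simp: S_def)
  then have vv: "v \<bullet> v = 1"
    by (simp add: norm_eq_1)
  define u where "u = A *v v - \<mu> *\<^sub>R v"
  have uW: "u \<in> W"
    unfolding u_def using W vW by (intro subspace_diff subspace_scale) auto
  define c where "c = u \<bullet> (A *v u) - \<mu> * (u \<bullet> u)"
  \<comment> \<open>\<open>bound\<close> is homogeneous, so \<open>v + e *\<^sub>R u\<close> does
    not have to be normalised. The coefficient of e is twice the squared norm of \<open>u\<close>,
    and \<open>c\<close> collects the second-order part.\<close>
  have ineq: "2 * e * (u \<bullet> u) + e\<^sup>2 * c \<le> 0" for e
  proof -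
    have sym: "v \<bullet> (A *v u) = u \<bullet> (A *v v)"
      by (metis A inner_commute inner_matrix_vector_mult)
    have "v + e *\<^sub>R u \<in> W"
      using W vW uW by (intro subspace_add subspace_scale) auto
    from bound [OF this]
    have "\<mu> + 2 * e * (u \<bullet> (A *v v)) + e\<^sup>2 * (u \<bullet> (A *v u)) \<le> \<mu> * (1 + 2 * e * (u \<bullet> v) + e\<^sup>2 * (u \<bullet> u))"
      by (simp add: matrix_vector_right_distrib matrix_vector_mult_scaleR_right inner_add_left
          inner_add_right vv sym \<mu>_def inner_commute [of v u] power2_eq_square algebra_simps)
    moreover have "u \<bullet> u = u \<bullet> (A *v v) - \<mu> * (u \<bullet> v)"
      by (simp add: u_def inner_diff_right)
    then have "u \<bullet> (A *v v) = u \<bullet> u + \<mu> * (u \<bullet> v)"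
      by simp
    ultimately show ?thesis
      by (simp add: c_def algebra_simps)
  qed
  have "u \<bullet> u \<le> 0"
  proof (rule ccontr)
    assume "\<not> u \<bullet> u \<le> 0"
    \<comment> \<open>Small enough that the second-order term cannot outweigh the first-order
      one.\<close>
    define e where "e = (u \<bullet> u) / (\<bar>c\<bar> + 1)"
    have e: "0 < e" "e * \<bar>c\<bar> < u \<bullet> u"
      using \<open>\<not> u \<bullet> u \<le> 0\<close> by (auto simp: e_def divide_simps algebra_simps)
    have "e * (2 * (u \<bullet> u) + e * c) \<le> 0"
      using ineq [of e] by (simp add: algebra_simps power2_eq_square)
    then have "2 * (u \<bullet> u) + e * c \<le> 0"
      using e(1) by (simp add: mult_le_0_iff)
    moreover have "- (e * \<bar>c\<bar>) \<le> e * c"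
      using e(1) by (metis abs_ge_minus_self abs_mult abs_of_pos minus_le_iff)
    ultimately show False
      using e(2) \<open>\<not> u \<bullet> u \<le> 0\<close> by linarith
  qed
  then have "A *v v = \<mu> *\<^sub>R v"
    by (metis eq_iff_diff_eq_0 inner_eq_zero_iff inner_ge_zero order_antisym u_def)
  with vW norm_v show thesis
    by (rule that)
qed

text \<open>The eigenvectors are indexed by subsets of the column type, so the induction ends with a
  square matrix. Each new one is found in the complement of the previous ones for the complex
  Hermitian product, which A leaves invariant.\<close>

lemma orthonormal_eigenvectors_exist:
  fixes A :: "complex^'n^'n" and I :: "'n set"
  assumes A: "adjoint_mat A = A"
  shows "\<exists>(u :: 'n \<Rightarrow> complex^'n) d. 
    (\<forall>i\<in>I. \<forall>j\<in>I. (\<Sum>k\<in>UNIV. cnj (u i $ k) * u j $ k) = (if i = j then 1 else 0)) \<and>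
    (\<forall>i\<in>I. A *v u i = d i *\<^sub>R u i)"
  using finite [of I]
proof (induction I rule: finite_induct)
  case empty
  show ?case by simp
next
  case (insert m I)
  then obtain u :: "'n \<Rightarrow> complex^'n" and d where
    on: "\<And>i j. i \<in> I \<Longrightarrow> j \<in> I \<Longrightarrow> (\<Sum>k\<in>UNIV. cnj (u i $ k) * u j $ k) = (if i = j then 1 else 0)" and
    ev: "\<And>i. i \<in> I \<Longrightarrow> A *v u i = d i *\<^sub>R u i"
    by blast
  define W where "W = {w. \<forall>i\<in>I. (\<Sum>k\<in>UNIV. cnj (u i $ k) * w $ k) = 0}"
  \<comment> \<open>The kernel of \<open>M\<close> is \<open>W\<close>. Row m of \<open>M\<close> is
    zero, so \<open>M\<close> is not invertible and \<open>W\<close> contains a nonzero vector; this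
    replaces a dimension count.\<close>
  define M :: "complex^'n^'n" where "M = (\<chi> r c. if r \<in> I then cnj (u r $ c) else 0)"
  have W_iff: "w \<in> W \<longleftrightarrow> M *v w = 0" for w
  proof -
    have "(M *v w) $ i = (if i \<in> I then \<Sum>k\<in>UNIV. cnj (u i $ k) * w $ k else 0)" for i
      by (simp add: M_def matrix_vector_mult_def)
    then show ?thesis
      by (auto simp: W_def vec_eq_iff)
  qed
  have "subspace W"
  proof -
    have "W = {w. M *v w = 0}"
      using W_iff by blast
    then show ?thesis
      by (simp add: subspace_def matrix_vector_right_distrib matrix_vector_mult_scaleR_right)
  qed
  moreover have "A *v w \<in> W" if "w \<in> W" for w
  proof -
    have "(\<Sum>k\<in>UNIV. cnj (u i $ k) * (A *v w) $ k) = 0" if i: "i \<in> I" for i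
    proof -
      have A_nth: "A $ k $ l = cnj (A $ l $ k)" for k l
        by (metis A adjoint_mat_nth)
      have "(\<Sum>k\<in>UNIV. cnj (u i $ k) * (A *v w) $ k) =
          (\<Sum>k\<in>UNIV. \<Sum>l\<in>UNIV. cnj (u i $ k) * (A $ k $ l * w $ l))"
        by (simp add: matrix_vector_mult_def sum_distrib_left)
      also have "\<dots> = (\<Sum>l\<in>UNIV. \<Sum>k\<in>UNIV. cnj (A $ l $ k * u i $ k) * w $ l)"
        by (subst sum.swap, subst A_nth) (simp add: mult_ac)
      also have "\<dots> = (\<Sum>l\<in>UNIV. cnj ((A *v u i) $ l) * w $ l)"
        by (simp add: matrix_vector_mult_def sum_distrib_right)
      also have "\<dots> = d i *\<^sub>R (\<Sum>l\<in>UNIV. cnj (u i $ l) * w $ l)"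
        by (simp add: ev i scaleR_sum_right)
      also have "\<dots> = 0"
        using \<open>w \<in> W\<close> i by (simp add: W_def)
      finally show ?thesis .
    qed
    then show ?thesis
      by (simp add: W_def)
  qed
  moreover have "\<exists>x. M *v x = 0 \<and> x \<noteq> 0"
  proof (rule ccontr)
    assume "\<not> ?thesis"
    then obtain B where "B ** M = mat 1"
      by (meson matrix_left_invertible_ker)
    then have "M ** B = mat 1"
      by (simp add: matrix_left_right_inverse)
    then have "(M ** B) $ m $ m = 1"
      by (simp add: mat_def)
    then show False
      using \<open>m \<notin> I\<close> by (simp add: M_def matrix_matrix_mult_def)
  qed
  ultimately obtain v \<mu> where v: "v \<in> W" "norm v = 1" "A *v v = \<mu> *\<^sub>R v"
    using hermitian_eigenvector_in_subspace [OF A] by (metis W_iff)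
  have vv: "(\<Sum>k\<in>UNIV. cnj (v $ k) * v $ k) = 1"
  proof -
    have "v \<bullet> v = 1"
      using v(2) by (simp add: norm_eq_1)
    then have "(\<Sum>k\<in>UNIV. (cmod (v $ k))\<^sup>2) = 1"
      by (simp add: inner_vec_def power2_norm_eq_inner)
    then have "complex_of_real (\<Sum>k\<in>UNIV. (cmod (v $ k))\<^sup>2) = 1"
      by simp
    then show ?thesis
      unfolding of_real_sum complex_norm_square by (simp add: mult.commute)
  qed
  have uv: "(\<Sum>k\<in>UNIV. cnj (u i $ k) * v $ k) = 0" if "i \<in> I" for i
    using v(1) that by (simp add: W_def)
  have vu: "(\<Sum>k\<in>UNIV. cnj (v $ k) * u i $ k) = 0" if "i \<in> I" for i
  proof -
    have "(\<Sum>k\<in>UNIV. cnj (v $ k) * u i $ k) = cnj (\<Sum>k\<in>UNIV. cnj (u i $ k) * v $ k)"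
      by (simp add: mult.commute)
    then show ?thesis
      by (simp add: uv that)
  qed
  show ?case
  proof (intro exI conjI ballI)
    show "(\<Sum>k\<in>UNIV. cnj ((u(m := v)) i $ k) * (u(m := v)) j $ k) = (if i = j then 1 else 0)"
      if "i \<in> insert m I" "j \<in> insert m I" for i j
      using that \<open>m \<notin> I\<close> by (auto simp: vv uv vu on)
    show "A *v (u(m := v)) i = (d(m := \<mu>)) i *\<^sub>R (u(m := v)) i" if "i \<in> insert m I" for i
      using that \<open>m \<notin> I\<close> by (auto simp: ev v)
  qed
qed

theorem hermitian_diagonalization:
  fixes A :: "complex^'n^'n"
  assumes "adjoint_mat A = A"
  obtains U d where "unitary_mat U" "A = U ** real_diag d ** adjoint_mat U"
proof -
  obtain u :: "'n \<Rightarrow> complex^'n" and d where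
    on: "\<And>i j. (\<Sum>k\<in>UNIV. cnj (u i $ k) * u j $ k) = (if i = j then 1 else 0)" and
    ev: "\<And>i. A *v u i = d i *\<^sub>R u i"
    using orthonormal_eigenvectors_exist [OF assms, of UNIV] by auto
  define U :: "complex^'n^'n" where "U = (\<chi> r c. u c $ r)"
  have "adjoint_mat U ** U = mat 1"
    by (simp add: vec_eq_iff matrix_matrix_mult_def U_def mat_def on)
  then have U: "unitary_mat U"
    by (simp add: unitary_mat_def matrix_left_right_inverse)
  have "(A ** U) $ r $ c = (U ** real_diag d) $ r $ c" for r c
  proof -
    have "(A ** U) $ r $ c = (A *v u c) $ r"
      by (simp add: matrix_matrix_mult_def matrix_vector_mult_def U_def)
    then show ?thesis
      by (simp add: matrix_mult_real_diag_right ev U_def scaleR_conv_of_real [where 'a = complex] mult.commute)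
  qed
  then have "A ** U = U ** real_diag d"
    by (simp add: vec_eq_iff)
  then have "A = U ** real_diag d ** adjoint_mat U"
    using U by (metis matrix_mul_assoc matrix_mul_rid unitary_mat_def)
  with U show thesis
    by (rule that)
qed

section \<open>Relative entropy through resolvents\<close>

lemma inner_unitary_left: "unitary_mat U \<Longrightarrow> (U ** A) \<bullet> (U ** B) = A \<bullet> B"
  by (simp add: inner_matrix_mult_left unitary_mat_def matrix_mul_assoc)

lemma inner_unitary_right:
  assumes "unitary_mat U"
  shows "(A ** adjoint_mat U) \<bullet> (B ** adjoint_mat U) = A \<bullet> B"
proof -
  have "(A ** adjoint_mat U) \<bullet> (B ** adjoint_mat U) = A \<bullet> (B ** (adjoint_mat U ** U))"
    by (simp add: inner_matrix_mult_right matrix_mul_assoc)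
  with assms show ?thesis
    by (simp add: unitary_mat_def)
qed

lemma inner_real_diag: "A \<bullet> real_diag d = (\<Sum>i\<in>UNIV. d i * Re (A $ i $ i))"
proof -
  have "A $ i $ j \<bullet> real_diag d $ i $ j = (if j = i then d i * Re (A $ i $ i) else 0)" for i j
    by (simp add: real_diag_def inner_complex_def)
  then show ?thesis
    by (simp add: inner_vec_def)
qed

lemma of_real_cmod_power2: "(complex_of_real (cmod z))\<^sup>2 = z * cnj z"
  using complex_norm_square [of z] by simp

lemma mult_complex_of_real:
  "z * complex_of_real r = r *\<^sub>R z" "complex_of_real r * z = r *\<^sub>R z"
  by (simp_all add: scaleR_conv_of_real)

lemma mult_real_diag_adjoint_diag:
  "Re ((W ** real_diag s ** adjoint_mat W) $ j $ j) = (\<Sum>i\<in>UNIV. (cmod (W $ j $ i))\<^sup>2 * s i)"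
proof -
  have "(W ** real_diag s ** adjoint_mat W) $ j $ j = 
      (\<Sum>i\<in>UNIV. complex_of_real ((cmod (W $ j $ i))\<^sup>2 * s i))"
    unfolding matrix_matrix_mult_def [of "W ** real_diag s"]
    by (simp add: matrix_mult_real_diag_right of_real_cmod_power2 mult_ac)
  then show ?thesis
    by simp
qed

lemma sum_cmod_sq_unitary:
  assumes "unitary_mat W"
  shows "(\<Sum>j\<in>UNIV. (cmod (W $ j $ i))\<^sup>2) = 1"
proof -
  have "complex_of_real (\<Sum>j\<in>UNIV. (cmod (W $ j $ i))\<^sup>2) = (adjoint_mat W ** W) $ i $ i"
    unfolding of_real_sum of_real_power of_real_cmod_power2 by (simp add: matrix_matrix_mult_def mult.commute)
  also have "\<dots> = 1"
    using assms by (simp add: unitary_mat_def mat_def)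
  finally show ?thesis
    by (simp only: of_real_eq_1_iff)
qed

lemma unitary_mat_adjoint: "unitary_mat U \<Longrightarrow> unitary_mat (adjoint_mat U)"
  by (simp add: unitary_mat_def)

lemma unitary_mat_mult:
  assumes "unitary_mat U" "unitary_mat V"
  shows "unitary_mat (U ** V)"
proof -
  have "adjoint_mat (U ** V) ** (U ** V) = adjoint_mat V ** (adjoint_mat U ** U) ** V"
    by (simp add: adjoint_mat_mult matrix_mul_assoc)
  then have "adjoint_mat (U ** V) ** (U ** V) = mat 1"
    using assms by (simp add: unitary_mat_def)
  then show ?thesis
    by (simp add: unitary_mat_def matrix_left_right_inverse)
qed

lemma quadratic_form_diag:
  "v \<bullet> ((U ** real_diag d ** adjoint_mat U) *v v) =
     (\<Sum>i\<in>UNIV. d i * (cmod ((adjoint_mat U *v v) $ i))\<^sup>2)"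
proof -
  define w where "w = adjoint_mat U *v v"
  have "v \<bullet> ((U ** real_diag d ** adjoint_mat U) *v v) = w \<bullet> (real_diag d *v w)"
    unfolding w_def by (simp add: inner_matrix_vector_mult flip: matrix_vector_mul_assoc)
  also have "\<dots> = (\<Sum>i\<in>UNIV. d i * (cmod (w $ i))\<^sup>2)"
  proof -
    have "(real_diag d *v w) $ i = d i *\<^sub>R w $ i" for i
      by (simp add: matrix_vector_mult_def real_diag_def scaleR_conv_of_real [where 'a = complex]
          mult_delta_left)
    then show ?thesis
      by (simp add: inner_vec_def power2_norm_eq_inner)
  qed
  finally show ?thesis
    by (simp add: w_def)
qed

text \<open>The test vector is column j of \<open>V\<close>. With \<open>V\<close> equal to
  \<open>U\<close> the form returns the eigenvalue \<open>d j\<close>; with two eigenbases it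
  returns the overlaps that the support condition controls.\<close>

lemma quadratic_form_eigenvector:
  assumes "unitary_mat V"
  shows "(V *v axis j 1) \<bullet> ((U ** real_diag d ** adjoint_mat U) *v (V *v axis j 1)) =
    (\<Sum>i\<in>UNIV. d i * (cmod ((adjoint_mat V ** U) $ j $ i))\<^sup>2)"
proof -
  have "(adjoint_mat U *v (V *v axis j 1)) $ i = cnj ((adjoint_mat V ** U) $ j $ i)" for i
    by (simp add: matrix_vector_mul_assoc matrix_vector_mul_component inner_axis matrix_vector_mult_def axis_def matrix_matrix_mult_def mult.commute if_distrib cong: if_cong)
  then show ?thesis
    by (simp add: quadratic_form_diag)
qed

lemma pos_semidef_diagonalization:
  assumes "pos_semidef A"
  obtains U d where "unitary_mat U" "A = U ** real_diag d ** adjoint_mat U" "\<And>i. 0 \<le> d i"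
proof -
  have "adjoint_mat A = A"
    using assms by (simp add: pos_semidef_def)
  then obtain U d where U: "unitary_mat U" "A = U ** real_diag d ** adjoint_mat U"
    by (rule hermitian_diagonalization)
  have "0 \<le> d j" for j
  proof -
    have "0 \<le> (U *v axis j 1) \<bullet> (A *v (U *v axis j 1))"
      using assms by (simp add: pos_semidef_altdef)
    also have "\<dots> = (\<Sum>i\<in>UNIV. d i * (cmod (mat 1 $ j $ i))\<^sup>2)"
      using U(1) unfolding U(2) quadratic_form_eigenvector [OF U(1)] by (simp add: unitary_mat_def)
    also have "\<dots> = (\<Sum>i\<in>UNIV. if i = j then d j else 0)"
      by (intro sum.cong) (auto simp: mat_def)
    finally show ?thesis
      by simp
  qed
  with U show thesis
    by (rule that)
qed

text \<open>In HOL \<open>ln 0 = 0\<close>, so the convention on the kernel is already that of the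
  plain \<open>ln\<close>.\<close>

lemma log_mat_diag:
  assumes "unitary_mat U"
  shows "log_mat (U ** real_diag d ** adjoint_mat U) = U ** real_diag (\<lambda>i. ln (d i)) ** adjoint_mat U"
proof -
  have "(\<lambda>i. if d i = 0 then 0 else ln (d i)) = (\<lambda>i. ln (d i))"
    by auto
  with assms show ?thesis
    by (simp add: log_mat_def herm_fun_eq)
qed

text \<open>Tr S log T sees only the diagonal of S in the eigenbasis of T, whose entries are the s i
  weighted by squared overlaps. These overlaps sum to 1 over j, so Tr S log S can be spread over the
  same pairs. The result is a classical relative entropy, that of the Nussbaum-Szkola
  distributions.\<close>

lemma rel_entropy_diag:
  assumes U: "unitary_mat U" and V: "unitary_mat V"
  shows "rel_entropy (U ** real_diag s ** adjoint_mat U) (V ** real_diag t ** adjoint_mat V) =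
    (\<Sum>j\<in>UNIV. \<Sum>i\<in>UNIV. (cmod ((adjoint_mat V ** U) $ j $ i))\<^sup>2 * s i * (ln (s i) - ln (t j)))"
    (is "rel_entropy ?S ?T = _")
proof -
  define W where "W = adjoint_mat V ** U"
  have W: "unitary_mat W"
    unfolding W_def by (intro unitary_mat_mult unitary_mat_adjoint U V)
  have "?S \<bullet> log_mat ?S = (\<Sum>i\<in>UNIV. ln (s i) * s i)"
    unfolding log_mat_diag [OF U] inner_unitary_right [OF U] inner_unitary_left [OF U] inner_real_diag
    by (simp add: real_diag_def)
  also have "\<dots> = (\<Sum>i\<in>UNIV. (\<Sum>j\<in>UNIV. (cmod (W $ j $ i))\<^sup>2) * s i * ln (s i))"
    by (simp add: sum_cmod_sq_unitary [OF W] mult.commute)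
  also have "\<dots> = (\<Sum>j\<in>UNIV. \<Sum>i\<in>UNIV. (cmod (W $ j $ i))\<^sup>2 * s i * ln (s i))"
    unfolding sum_distrib_right by (rule sum.swap)
  finally have 1: "?S \<bullet> log_mat ?S = \<dots>" .
  have "?S \<bullet> log_mat ?T = (?S ** V) \<bullet> (V ** real_diag (\<lambda>j. ln (t j)))"
    unfolding log_mat_diag [OF V] by (rule inner_matrix_mult_right [symmetric])
  also have "\<dots> = (adjoint_mat V ** ?S ** V) \<bullet> real_diag (\<lambda>j. ln (t j))"
    unfolding matrix_mul_assoc [of "adjoint_mat V" ?S V, symmetric] inner_matrix_mult_left [of "adjoint_mat V"]
    by simp
  also have "adjoint_mat V ** ?S ** V = W ** real_diag s ** adjoint_mat W"
    by (simp add: W_def adjoint_mat_mult matrix_mul_assoc)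
  also have "\<dots> \<bullet> real_diag (\<lambda>j. ln (t j)) = 
      (\<Sum>j\<in>UNIV. \<Sum>i\<in>UNIV. (cmod (W $ j $ i))\<^sup>2 * s i * ln (t j))"
    by (simp add: inner_real_diag mult_real_diag_adjoint_diag sum_distrib_left mult_ac)
  finally have 2: "?S \<bullet> log_mat ?T = \<dots>" .
  have "rel_entropy ?S ?T = ?S \<bullet> log_mat ?S - ?S \<bullet> log_mat ?T"
    by (simp add: rel_entropy_def trace_mult_eq_inner inner_diff_right adjoint_mat_mult matrix_mul_assoc)
  then show ?thesis
    by (simp add: 1 2 W_def sum_subtractf right_diff_distrib)
qed

text \<open>
  The supremum of this form over \<open>Z\<close> is \<open>\<langle>S, (L\<^sub>T + x R\<^sub>S)\<^sup>-\<^sup>1 S\<rangle>\<close>, where \<open>L\<^sub>T\<close> and \<open>R\<^sub>S\<close> denote left and right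
  multiplication; relative entropy is an integral over \<open>x\<close> of these suprema.
\<close>

definition resolvent_form :: "real \<Rightarrow> complex^'n^'n \<Rightarrow> complex^'n^'n \<Rightarrow> complex^'n^'n \<Rightarrow> real" where
  "resolvent_form x S T Z = 2 * (Z \<bullet> S) - Z \<bullet> (T ** Z) - x * (Z \<bullet> (Z ** S))"

text \<open>In the eigenbasis of T on the left and of S on the right, both multiplications act
  diagonally, so the form splits into one scalar quadratic for each entry of
  \<open>Y\<close>.\<close>

lemma resolvent_form_diag:
  assumes U: "unitary_mat U" and V: "unitary_mat V"
  shows "resolvent_form x (U ** real_diag s ** adjoint_mat U) (V ** real_diag t ** adjoint_mat V)
      (V ** Y ** adjoint_mat U) =
    (\<Sum>j\<in>UNIV. \<Sum>i\<in>UNIV. 2 * s i * (Y $ j $ i \<bullet> (adjoint_mat V ** U) $ j $ i)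
       - (t j + x * s i) * (cmod (Y $ j $ i))\<^sup>2)"
    (is "resolvent_form x ?S ?T ?Z = _")
proof -
  have UU: "adjoint_mat U ** U = mat 1" and VV: "adjoint_mat V ** V = mat 1"
    using U V by (simp_all add: unitary_mat_def)
  have "?Z \<bullet> ?S = (V ** Y) \<bullet> (U ** real_diag s)"
    by (rule inner_unitary_right [OF U])
  also have "\<dots> = Y \<bullet> ((adjoint_mat V ** U) ** real_diag s)"
    by (simp add: inner_matrix_mult_left matrix_mul_assoc)
  also have "\<dots> = (\<Sum>j\<in>UNIV. \<Sum>i\<in>UNIV. s i * (Y $ j $ i \<bullet> (adjoint_mat V ** U) $ j $ i))"
    by (simp add: inner_vec_def matrix_mult_real_diag_right mult_complex_of_real)
  finally have 1: "?Z \<bullet> ?S = \<dots>" .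
  have "?T ** ?Z = V ** (real_diag t ** (adjoint_mat V ** V) ** Y) ** adjoint_mat U"
    by (simp add: matrix_mul_assoc)
  then have "?Z \<bullet> (?T ** ?Z) = Y \<bullet> (real_diag t ** Y)"
    by (simp add: VV inner_unitary_right [OF U] inner_unitary_left [OF V])
  also have "\<dots> = (\<Sum>j\<in>UNIV. \<Sum>i\<in>UNIV. t j * (cmod (Y $ j $ i))\<^sup>2)"
    by (simp add: inner_vec_def matrix_mult_real_diag_left mult_complex_of_real power2_norm_eq_inner)
  finally have 2: "?Z \<bullet> (?T ** ?Z) = \<dots>" .
  have "?Z ** ?S = V ** (Y ** (adjoint_mat U ** U) ** real_diag s) ** adjoint_mat U"
    by (simp add: matrix_mul_assoc)
  then have "?Z \<bullet> (?Z ** ?S) = Y \<bullet> (Y ** real_diag s)"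
    by (simp add: UU inner_unitary_right [OF U] inner_unitary_left [OF V])
  also have "\<dots> = (\<Sum>j\<in>UNIV. \<Sum>i\<in>UNIV. s i * (cmod (Y $ j $ i))\<^sup>2)"
    by (simp add: inner_vec_def matrix_mult_real_diag_right mult_complex_of_real power2_norm_eq_inner)
  finally have 3: "?Z \<bullet> (?Z ** ?S) = \<dots>" .
  show ?thesis
    unfolding resolvent_form_def 1 2 3
    by (simp add: sum_distrib_left sum_subtractf sum.distrib distrib_right distrib_left diff_diff_eq mult.assoc)
qed

text \<open>
  The last assumption is the support condition; it makes the bound survive the division by zero.
\<close>

lemma resolvent_term_le:
  fixes y w :: complex and s t x :: real
  assumes "0 \<le> s" "0 \<le> t" "0 \<le> x" "t = 0 \<Longrightarrow> s = 0 \<or> w = 0"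
  shows "2 * s * (y \<bullet> w) - (t + x * s) * (cmod y)\<^sup>2 \<le> (cmod w)\<^sup>2 * s\<^sup>2 / (t + x * s)"
proof (cases "t + x * s = 0")
  case True
  then have "s = 0 \<or> w = 0"
    using assms by (simp add: add_nonneg_eq_0_iff)
  with True show ?thesis
    by auto
next
  case False
  then have pos: "0 < t + x * s"
    using assms by (simp add: order_less_le)
  define c where "c = t + x * s"
  have "0 \<le> (norm (c *\<^sub>R y - s *\<^sub>R w))\<^sup>2"
    by simp
  also have "\<dots> = c\<^sup>2 * (cmod y)\<^sup>2 + s\<^sup>2 * (cmod w)\<^sup>2 - 2 * c * s * (y \<bullet> w)"
    unfolding power2_norm_eq_inner
    by (simp add: inner_diff_left inner_diff_right inner_commute power2_eq_square algebra_simps)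
  finally have "c * (2 * s * (y \<bullet> w) - c * (cmod y)\<^sup>2) \<le> (cmod w)\<^sup>2 * s\<^sup>2"
    by (simp add: power2_eq_square algebra_simps)
  with pos show ?thesis
    unfolding c_def [symmetric] by (simp add: pos_le_divide_eq mult.commute)
qed

text \<open>The multiple s / c of w is the vertex of the scalar quadratic. For c = 0 division by
  zero gives the vertex 0 and the value 0, so the maximum is still attained.\<close>

lemma resolvent_term_eq:
  fixes w :: complex and s c :: real
  shows "2 * s * ((s / c) *\<^sub>R w \<bullet> w) - c * (cmod ((s / c) *\<^sub>R w))\<^sup>2 = (cmod w)\<^sup>2 * s\<^sup>2 / c"
  unfolding power2_norm_eq_inner by (cases "c = 0") (auto simp: power2_eq_square)

text \<open>Hides the eigenbases: for entropy, trace and all suprema the pair (S, T) behaves like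
  scalars s a, t a with weights w a. A supremum is recorded as a bound together with a point that
  attains it. The free index type lets pairs of different dimensions be compared, and the factor c
  records homogeneity.\<close>

definition resolvent_spectrum ::
    "complex^'n^'n \<Rightarrow> complex^'n^'n \<Rightarrow> ('a \<Rightarrow> real) \<Rightarrow> ('a::finite \<Rightarrow> real) \<Rightarrow> ('a \<Rightarrow> real) \<Rightarrow> bool" where
  "resolvent_spectrum S T w s t \<longleftrightarrow>
     (\<forall>a. 0 \<le> w a \<and> 0 \<le> s a \<and> 0 \<le> t a \<and> (t a = 0 \<longrightarrow> w a * s a = 0)) \<and>
     (\<forall>c>0. rel_entropy (c *\<^sub>R S) (c *\<^sub>R T) = c * (\<Sum>a\<in>UNIV. w a * s a * (ln (s a) - ln (t a)))) \<and>
     Re (trace S) = (\<Sum>a\<in>UNIV. w a * s a) \<and>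
     (\<forall>x\<ge>0. (\<forall>Z. resolvent_form x S T Z \<le> (\<Sum>a\<in>UNIV. w a * (s a)\<^sup>2 / (t a + x * s a))) \<and>
       (\<exists>Z. resolvent_form x S T Z = (\<Sum>a\<in>UNIV. w a * (s a)\<^sup>2 / (t a + x * s a))))"

lemma resolvent_spectrum_exists:
  fixes S T :: "complex^'n^'n"
  assumes S: "pos_semidef S" and T: "pos_semidef T"
    and supp: "\<And>v. v \<bullet> (T *v v) = 0 \<Longrightarrow> v \<bullet> (S *v v) = 0"
  shows "\<exists>w s (t :: 'n \<times> 'n \<Rightarrow> real). resolvent_spectrum S T w s t"
proof -
  obtain U s where U: "unitary_mat U" and S_eq: "S = U ** real_diag s ** adjoint_mat U" and s: "\<And>i. 0 \<le> s i"
    using pos_semidef_diagonalization [OF S] by blast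
  obtain V t where V: "unitary_mat V" and T_eq: "T = V ** real_diag t ** adjoint_mat V" and t: "\<And>i. 0 \<le> t i"
    using pos_semidef_diagonalization [OF T] by blast
  define W where "W = adjoint_mat V ** U"
  have W: "unitary_mat W"
    unfolding W_def by (intro unitary_mat_mult unitary_mat_adjoint U V)
  \<comment> \<open>A kernel eigenvector of T is null for S as well, so it has no overlap with an
    eigenvector of S of positive eigenvalue.\<close>
  have guard: "s i = 0 \<or> W $ j $ i = 0" if "t j = 0" for i j
  proof -
    define v where "v = V *v axis j 1"
    have "v \<bullet> (T *v v) = (\<Sum>i\<in>UNIV. t i * (cmod (mat 1 $ j $ i))\<^sup>2)"
      using V unfolding T_eq v_def quadratic_form_eigenvector [OF V] by (simp add: unitary_mat_def)
    also have "\<dots> = 0"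
      using that by (intro sum.neutral) (auto simp: mat_def)
    finally have "v \<bullet> (S *v v) = 0"
      by (rule supp)
    then have "(\<Sum>i\<in>UNIV. s i * (cmod (W $ j $ i))\<^sup>2) = 0"
      unfolding S_eq v_def quadratic_form_eigenvector [OF V] W_def .
    then have "s i * (cmod (W $ j $ i))\<^sup>2 = 0"
      by (subst (asm) sum_nonneg_eq_0_iff) (auto simp: s)
    then show ?thesis
      by auto
  qed
  have sum_pairs: "(\<Sum>a\<in>UNIV. F (fst a) (snd a)) = (\<Sum>j\<in>UNIV. \<Sum>i\<in>UNIV. F j i)"
    for F :: "'n \<Rightarrow> 'n \<Rightarrow> real"
    by (simp add: sum.cartesian_product case_prod_beta flip: UNIV_Times_UNIV)
  define w' where "w' = (\<lambda>a. (cmod (W $ fst a $ snd a))\<^sup>2)"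
  define s' where "s' = (\<lambda>a::'n\<times>'n. s (snd a))"
  define t' where "t' = (\<lambda>a::'n\<times>'n. t (fst a))"
  have "resolvent_spectrum S T w' s' t'"
    unfolding resolvent_spectrum_def
  proof (intro conjI allI impI)
    show "0 \<le> w' a" "0 \<le> s' a" "0 \<le> t' a" for a
      by (simp_all add: w'_def s'_def t'_def s t)
    show "w' a * s' a = 0" if "t' a = 0" for a
      using guard [of "fst a" "snd a"] that by (auto simp: w'_def s'_def t'_def)
    show "rel_entropy (c *\<^sub>R S) (c *\<^sub>R T) = c * (\<Sum>a\<in>UNIV. w' a * s' a * (ln (s' a) - ln (t' a)))"
      if c: "0 < c" for c
    proof -
      have scale: "c *\<^sub>R (A ** real_diag d ** adjoint_mat A) = A ** real_diag (\<lambda>i. c * d i) ** adjoint_mat A"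
        for A :: "complex^'n^'n" and d
      proof -
        have "real_diag (\<lambda>i. c * d i) = (c *\<^sub>R real_diag d :: complex^'n^'n)"
          by (simp add: vec_eq_iff real_diag_def scaleR_conv_of_real [where 'a = complex])
        then show ?thesis
          by (simp add: matrix_mult_scaleR_left matrix_mult_scaleR_right)
      qed
      have "rel_entropy (c *\<^sub>R S) (c *\<^sub>R T) = 
        (\<Sum>j\<in>UNIV. \<Sum>i\<in>UNIV. (cmod (W $ j $ i))\<^sup>2 * (c * s i) * (ln (c * s i) - ln (c * t j)))"
        unfolding S_eq T_eq scale rel_entropy_diag [OF U V] W_def ..
      also have "\<dots> = (\<Sum>j\<in>UNIV. \<Sum>i\<in>UNIV. c * ((cmod (W $ j $ i))\<^sup>2 * s i * (ln (s i) - ln (t j))))"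
      proof (intro sum.cong refl)
        fix j i
        show "(cmod (W $ j $ i))\<^sup>2 * (c * s i) * (ln (c * s i) - ln (c * t j)) =
          c * ((cmod (W $ j $ i))\<^sup>2 * s i * (ln (s i) - ln (t j)))"
        proof (cases "s i = 0 \<or> W $ j $ i = 0")
          case False
          then have "0 < s i" "0 < t j"
            using s [of i] t [of j] guard [of j i] by (auto simp: order_less_le)
          then show ?thesis
            using c by (simp add: ln_mult)
        qed auto
      qed
      also have "\<dots> = (\<Sum>a\<in>UNIV. c * (w' a * s' a * (ln (s' a) - ln (t' a))))"
        unfolding w'_def s'_def t'_def by (rule sum_pairs [symmetric])
      finally show ?thesis
        by (simp add: sum_distrib_left)
    qed
    have "Re (trace S) = adjoint_mat (U ** real_diag s) \<bullet> adjoint_mat U"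
      unfolding S_eq trace_mult_eq_inner ..
    also have "\<dots> = real_diag s \<bullet> (adjoint_mat U ** U)"
      unfolding inner_adjoint_mat by (simp add: inner_matrix_mult_left)
    also have "\<dots> = (\<Sum>i\<in>UNIV. s i)"
      using U inner_real_diag [of "mat 1" s] by (simp add: unitary_mat_def inner_commute mat_def)
    also have "\<dots> = (\<Sum>i\<in>UNIV. \<Sum>j\<in>UNIV. (cmod (W $ j $ i))\<^sup>2 * s i)"
      by (simp add: sum_cmod_sq_unitary [OF W] flip: sum_distrib_right)
    also have "\<dots> = (\<Sum>j\<in>UNIV. \<Sum>i\<in>UNIV. (cmod (W $ j $ i))\<^sup>2 * s i)"
      by (rule sum.swap)
    also have "\<dots> = (\<Sum>a\<in>UNIV. w' a * s' a)"
      unfolding w'_def s'_def by (rule sum_pairs [symmetric])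
    finally show "Re (trace S) = (\<Sum>a\<in>UNIV. w' a * s' a)" .
    show "resolvent_form x S T Z \<le> (\<Sum>a\<in>UNIV. w' a * (s' a)\<^sup>2 / (t' a + x * s' a))" if "0 \<le> x" for x Z
    proof -
      define Y where "Y = adjoint_mat V ** Z ** U"
      have "V ** Y ** adjoint_mat U = (V ** adjoint_mat V) ** Z ** (U ** adjoint_mat U)"
        unfolding Y_def by (simp only: matrix_mul_assoc)
      then have "Z = V ** Y ** adjoint_mat U"
        using U V by (simp add: unitary_mat_def)
      then have "resolvent_form x S T Z = 
        (\<Sum>j\<in>UNIV. \<Sum>i\<in>UNIV. 2 * s i * (Y $ j $ i \<bullet> W $ j $ i) - (t j + x * s i) * (cmod (Y $ j $ i))\<^sup>2)"
        unfolding S_eq T_eq W_def by (simp only: resolvent_form_diag [OF U V])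
      also have "\<dots> \<le> (\<Sum>j\<in>UNIV. \<Sum>i\<in>UNIV. (cmod (W $ j $ i))\<^sup>2 * (s i)\<^sup>2 / (t j + x * s i))"
        by (intro sum_mono resolvent_term_le s t guard that)
      also have "\<dots> = (\<Sum>a\<in>UNIV. w' a * (s' a)\<^sup>2 / (t' a + x * s' a))"
        unfolding w'_def s'_def t'_def by (rule sum_pairs [symmetric])
      finally show ?thesis .
    qed
    show "\<exists>Z. resolvent_form x S T Z = (\<Sum>a\<in>UNIV. w' a * (s' a)\<^sup>2 / (t' a + x * s' a))" for x
    proof -
      define Y :: "complex^'n^'n" where "Y = (\<chi> j i. (s i / (t j + x * s i)) *\<^sub>R W $ j $ i)"
      have "resolvent_form x S T (V ** Y ** adjoint_mat U) = 
        (\<Sum>j\<in>UNIV. \<Sum>i\<in>UNIV. 2 * s i * (Y $ j $ i \<bullet> W $ j $ i) - (t j + x * s i) * (cmod (Y $ j $ i))\<^sup>2)"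
        unfolding S_eq T_eq W_def by (simp only: resolvent_form_diag [OF U V])
      also have "\<dots> = (\<Sum>j\<in>UNIV. \<Sum>i\<in>UNIV. (cmod (W $ j $ i))\<^sup>2 * (s i)\<^sup>2 / (t j + x * s i))"
        unfolding Y_def vec_lambda_beta resolvent_term_eq ..
      also have "\<dots> = (\<Sum>a\<in>UNIV. w' a * (s' a)\<^sup>2 / (t' a + x * s' a))"
        unfolding w'_def s'_def t'_def by (rule sum_pairs [symmetric])
      finally show ?thesis
        by blast
    qed
  qed
  then show ?thesis
    by blast
qed

section \<open>Logarithms from primitives of resolvents\<close>

lemma log_ratio_deriv:
  fixes w s t x :: real
  assumes "0 \<le> s" "0 \<le> t" "t = 0 \<Longrightarrow> w * s = 0" "0 \<le> x"
  shows "((\<lambda>x. w * s * (ln (t + x * s) - ln (1 + x))) has_real_derivative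
    w * s\<^sup>2 / (t + x * s) - w * s / (1 + x)) (at x)"
proof (cases "w * s = 0")
  case True
  then show ?thesis
    by (cases "w = 0") auto
next
  case False
  then have "0 < t"
    using assms by (auto simp: order_less_le)
  then have "0 < t + x * s"
    using assms by (simp add: add_pos_nonneg)
  with assms show ?thesis
    by (auto intro!: derivative_eq_intros simp: divide_simps power2_eq_square)
      (simp_all add: algebra_simps)
qed

text \<open>The quotient (t + x s) / (1 + x) runs from t at 0 to s at infinity, so the primitive
  grows by ln s - ln t in total. The summand - ln (1 + x) is what makes the limit finite.\<close>

lemma log_ratio_tendsto:
  fixes w s t :: real
  assumes "0 \<le> s" "0 \<le> t" "t = 0 \<Longrightarrow> w * s = 0"
  shows "((\<lambda>x. w * s * (ln (t + x * s) - ln (1 + x))) \<longlongrightarrow> w * s * ln s) at_top"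
proof (cases "w * s = 0")
  case False
  then have "0 < t" "0 < s"
    using assms by (auto simp: order_less_le)
  then have "((\<lambda>x. ln (t + x * s) - ln (1 + x)) \<longlongrightarrow> ln s) at_top"
    by real_asymp
  then show ?thesis
    by (rule tendsto_mult_left)
qed auto

text \<open>
  The difference of the two functions \<open>x \<mapsto> \<Sum> w s (ln (t + x s) - ln (1 + x))\<close> has nonnegative
  derivative; its value at \<open>0\<close> is therefore at most its limit at infinity.
\<close>

lemma entropy_sum_mono:
  fixes w s t :: "'a \<Rightarrow> real" and w' s' t' :: "'b \<Rightarrow> real"
  assumes A: "\<And>a. a \<in> A \<Longrightarrow> 0 \<le> s a" "\<And>a. a \<in> A \<Longrightarrow> 0 \<le> t a" "\<And>a. a \<in> A \<Longrightarrow> t a = 0 \<Longrightarrow> w a * s a = 0"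
    and B: "\<And>b. b \<in> B \<Longrightarrow> 0 \<le> s' b" "\<And>b. b \<in> B \<Longrightarrow> 0 \<le> t' b" "\<And>b. b \<in> B \<Longrightarrow> t' b = 0 \<Longrightarrow> w' b * s' b = 0"
    and total: "(\<Sum>b\<in>B. w' b * s' b) = (\<Sum>a\<in>A. w a * s a)"
    and resolvents: "\<And>x. 0 \<le> x \<Longrightarrow>
      (\<Sum>b\<in>B. w' b * (s' b)\<^sup>2 / (t' b + x * s' b)) \<le> (\<Sum>a\<in>A. w a * (s a)\<^sup>2 / (t a + x * s a))"
  shows "(\<Sum>b\<in>B. w' b * s' b * (ln (s' b) - ln (t' b))) \<le> (\<Sum>a\<in>A. w a * s a * (ln (s a) - ln (t a)))"
proof -
  define \<Phi> where "\<Phi> = (\<lambda>x. (\<Sum>a\<in>A. w a * s a * (ln (t a + x * s a) - ln (1 + x)))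
    - (\<Sum>b\<in>B. w' b * s' b * (ln (t' b + x * s' b) - ln (1 + x))))"
  have deriv: "\<exists>D. (\<Phi> has_real_derivative D) (at x) \<and> 0 \<le> D" if "0 \<le> x" for x
  proof (intro exI conjI)
    show "(\<Phi> has_real_derivative
        (\<Sum>a\<in>A. w a * (s a)\<^sup>2 / (t a + x * s a) - w a * s a / (1 + x)) -
        (\<Sum>b\<in>B. w' b * (s' b)\<^sup>2 / (t' b + x * s' b) - w' b * s' b / (1 + x))) (at x)"
      unfolding \<Phi>_def by (intro DERIV_diff DERIV_sum log_ratio_deriv A B that)
    \<comment> \<open>The parts with 1 / (1 + x) cancel because both families have the same total
      weight.\<close>
    show "0 \<le> (\<Sum>a\<in>A. w a * (s a)\<^sup>2 / (t a + x * s a) - w a * s a / (1 + x)) -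
        (\<Sum>b\<in>B. w' b * (s' b)\<^sup>2 / (t' b + x * s' b) - w' b * s' b / (1 + x))"
      using resolvents [OF that] total by (simp add: sum_subtractf flip: sum_divide_distrib)
  qed
  have "\<Phi> 0 \<le> \<Phi> x" if "0 \<le> x" for x
    by (rule DERIV_nonneg_imp_nondecreasing [OF that deriv])
  then have "eventually (\<lambda>x. \<Phi> 0 \<le> \<Phi> x) at_top"
    by (rule eventually_at_top_linorderI)
  moreover have "(\<Phi> \<longlongrightarrow> (\<Sum>a\<in>A. w a * s a * ln (s a)) - (\<Sum>b\<in>B. w' b * s' b * ln (s' b))) at_top"
    unfolding \<Phi>_def by (intro tendsto_diff tendsto_sum log_ratio_tendsto A B)
  ultimately have "\<Phi> 0 \<le> (\<Sum>a\<in>A. w a * s a * ln (s a)) - (\<Sum>b\<in>B. w' b * s' b * ln (s' b))"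
    by (intro tendsto_lowerbound [of \<Phi> _ at_top]) auto
  then show ?thesis
    by (simp add: \<Phi>_def right_diff_distrib sum_subtractf)
qed

section \<open>Monotonicity of relative entropy\<close>

lemma pos_semidef_matrix_form:
  assumes "pos_semidef T"
  shows "0 \<le> X \<bullet> (T ** X)"
proof -
  have "X \<bullet> (T ** X) = (\<Sum>j\<in>UNIV. \<Sum>i\<in>UNIV. X $ i $ j \<bullet> (T ** X) $ i $ j)"
    unfolding inner_vec_def by (rule sum.swap)
  also have "\<dots> = (\<Sum>j\<in>UNIV. column j X \<bullet> (T *v column j X))"
    by (simp add: inner_vec_def column_def matrix_matrix_mult_def matrix_vector_mult_def)
  also have "\<dots> \<ge> 0"
    using assms by (intro sum_nonneg) (simp add: pos_semidef_altdef)
  finally show ?thesis .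
qed

text \<open>A Schwarz inequality of Kadison type. With \<open>A\<close> and \<open>Y\<close> as in
  the proof, both the cross terms and the squares of \<open>Y\<close> add up to the left-hand side,
  by the definition of \<open>X\<close> and by completeness of the \<open>K k\<close>; the claim is
  then nonnegativity of the summed forms of Y k - A k.\<close>

lemma matrix_form_instrument_le:
  fixes T :: "complex^'n^'n" and K :: "'k \<Rightarrow> complex^'n^'m" and Z :: "'k \<Rightarrow> complex^'m^'m"
  assumes T: "pos_semidef T" and K: "(\<Sum>k\<in>I. adjoint_mat (K k) ** K k) = mat 1"
  defines "X \<equiv> (\<Sum>k\<in>I. adjoint_mat (K k) ** Z k ** K k)"
  shows "X \<bullet> (T ** X) \<le> (\<Sum>k\<in>I. Z k \<bullet> ((K k ** T ** adjoint_mat (K k)) ** Z k))"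
proof -
  define A where "A = (\<lambda>k. adjoint_mat (K k) ** Z k)"
  define Y where "Y = (\<lambda>k. X ** adjoint_mat (K k))"
  have T_herm: "adjoint_mat T = T"
    using T by (simp add: pos_semidef_altdef)
  have sym: "P \<bullet> (T ** Q) = Q \<bullet> (T ** P)" for P Q :: "complex^'m^'n"
    by (metis T_herm inner_commute inner_matrix_mult_left)
  have "2 * (Y k \<bullet> (T ** A k)) \<le> Y k \<bullet> (T ** Y k) + A k \<bullet> (T ** A k)" for k
  proof -
    have "0 \<le> (Y k - A k) \<bullet> (T ** (Y k - A k))"
      by (rule pos_semidef_matrix_form [OF T])
    then show ?thesis
      by (simp add: matrix_mult_diff_right inner_diff_left inner_diff_right sym [of "A k" "Y k"])
  qed
  then have "(\<Sum>k\<in>I. 2 * (Y k \<bullet> (T ** A k))) \<le> (\<Sum>k\<in>I. Y k \<bullet> (T ** Y k) + A k \<bullet> (T ** A k))"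
    by (intro sum_mono)
  then have "2 * (\<Sum>k\<in>I. Y k \<bullet> (T ** A k)) \<le> (\<Sum>k\<in>I. Y k \<bullet> (T ** Y k)) + (\<Sum>k\<in>I. A k \<bullet> (T ** A k))"
    by (simp add: sum.distrib sum_distrib_left)
  moreover have "(\<Sum>k\<in>I. Y k \<bullet> (T ** A k)) = X \<bullet> (T ** X)"
  proof -
    have "(\<Sum>k\<in>I. Y k \<bullet> (T ** A k)) = (\<Sum>k\<in>I. X \<bullet> (T ** (A k ** K k)))"
      by (simp add: Y_def inner_matrix_mult_right matrix_mul_assoc)
    then show ?thesis
      by (simp add: X_def A_def matrix_mult_sum_right inner_sum_right)
  qed
  moreover have "(\<Sum>k\<in>I. Y k \<bullet> (T ** Y k)) = X \<bullet> (T ** X)"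
  proof -
    have "(\<Sum>k\<in>I. Y k \<bullet> (T ** Y k)) = (\<Sum>k\<in>I. X \<bullet> (T ** X ** (adjoint_mat (K k) ** K k)))"
      by (simp add: Y_def inner_matrix_mult_right matrix_mul_assoc)
    also have "\<dots> = X \<bullet> (T ** X ** (\<Sum>k\<in>I. adjoint_mat (K k) ** K k))"
      by (simp add: matrix_mult_sum_right inner_sum_right)
    finally show ?thesis
      by (simp add: K)
  qed
  moreover have "A k \<bullet> (T ** A k) = Z k \<bullet> ((K k ** T ** adjoint_mat (K k)) ** Z k)" for k
    by (simp add: A_def inner_matrix_mult_left matrix_mul_assoc)
  ultimately show ?thesis
    by simp
qed

text \<open>Test matrices travel against the measurement: the \<open>Z k\<close> are pulled back to
  a single one for (S, T). The linear term is preserved exactly, while the two subtracted quadratic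
  terms can only shrink.\<close>

lemma resolvent_form_instrument_le:
  fixes S T :: "complex^'n^'n" and K :: "'k \<Rightarrow> complex^'n^'m"
  assumes S: "pos_semidef S" and T: "pos_semidef T"
    and K: "(\<Sum>k\<in>I. adjoint_mat (K k) ** K k) = mat 1" and x: "0 \<le> x"
  shows "(\<Sum>k\<in>I. resolvent_form x (K k ** S ** adjoint_mat (K k)) (K k ** T ** adjoint_mat (K k)) (Z k))
    \<le> resolvent_form x S T (\<Sum>k\<in>I. adjoint_mat (K k) ** Z k ** K k)"
    (is "_ \<le> resolvent_form x S T ?X")
proof -
  have lin: "?X \<bullet> S = (\<Sum>k\<in>I. Z k \<bullet> (K k ** S ** adjoint_mat (K k)))"
    by (simp add: inner_sum_left matrix_mul_assoc inner_matrix_mult_right [where B = "K _"]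
        inner_matrix_mult_left [where A = "adjoint_mat (K _)"])
  \<comment> \<open>Passing to adjoints turns right multiplication by S into left multiplication, so
    the inequality for T also serves for S.\<close>
  have right_form: "Y \<bullet> (Y ** R) = adjoint_mat Y \<bullet> (R ** adjoint_mat Y)"
    if "pos_semidef R" for Y R :: "complex^'a^'a"
    using that by (simp add: pos_semidef_altdef inner_adjoint_mat flip: inner_adjoint_mat [of Y] add: adjoint_mat_mult)
  have adj_X: "adjoint_mat ?X = (\<Sum>k\<in>I. adjoint_mat (K k) ** adjoint_mat (Z k) ** K k)"
    by (induction I rule: infinite_finite_induct)
      (simp_all add: adjoint_mat_add adjoint_mat_mult matrix_mul_assoc vec_eq_iff)
  have "?X \<bullet> (?X ** S) = adjoint_mat ?X \<bullet> (S ** adjoint_mat ?X)"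
    by (rule right_form [OF S])
  also have "\<dots> \<le> (\<Sum>k\<in>I. adjoint_mat (Z k) \<bullet> ((K k ** S ** adjoint_mat (K k)) ** adjoint_mat (Z k)))"
    unfolding adj_X by (rule matrix_form_instrument_le [OF S K])
  also have "\<dots> = (\<Sum>k\<in>I. Z k \<bullet> (Z k ** (K k ** S ** adjoint_mat (K k))))"
    by (simp add: right_form pos_semidef_conj S)
  finally have "x * (?X \<bullet> (?X ** S)) \<le> x * (\<Sum>k\<in>I. Z k \<bullet> (Z k ** (K k ** S ** adjoint_mat (K k))))"
    using x by (rule mult_left_mono)
  with matrix_form_instrument_le [OF T K, of Z] show ?thesis
    by (simp add: resolvent_form_def lin sum_subtractf flip: sum_distrib_left)
qed

lemma trace_conj_sum:
  assumes K: "(\<Sum>k\<in>I. adjoint_mat (K k) ** K k) = mat 1"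
  shows "(\<Sum>k\<in>I. Re (trace (K k ** S ** adjoint_mat (K k)))) = Re (trace S)"
proof -
  have "Re (trace (K k ** S ** adjoint_mat (K k))) = S \<bullet> (adjoint_mat (K k) ** K k)" for k
    by (simp add: trace_eq_inner inner_matrix_mult_right [of _ "adjoint_mat (K k)"]
        inner_matrix_mult_left [of "K k"])
  then show ?thesis
    by (simp add: K trace_eq_inner flip: inner_sum_right)
qed

text \<open>The unnormalised outcomes are the blocks of a block-diagonal pair, so the sum is the
  relative entropy after the outcome is stored in a classical register. For each x, optimal test
  matrices of the blocks pull back to a competitor in the supremum for (S, T).\<close>

theorem rel_entropy_instrument_le:
  fixes S T :: "complex^'n^'n" and K :: "'k \<Rightarrow> complex^'n^'m"
  assumes S: "pos_semidef S" and T: "pos_semidef T"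
    and supp: "\<And>v. v \<bullet> (T *v v) = 0 \<Longrightarrow> v \<bullet> (S *v v) = 0"
    and K: "(\<Sum>k\<in>I. adjoint_mat (K k) ** K k) = mat 1"
  shows "(\<Sum>k\<in>I. rel_entropy (K k ** S ** adjoint_mat (K k)) (K k ** T ** adjoint_mat (K k)))
    \<le> rel_entropy S T"
proof -
  define S' T' where "S' k = K k ** S ** adjoint_mat (K k)" and "T' k = K k ** T ** adjoint_mat (K k)" for k
  obtain w s and t :: "'n \<times> 'n \<Rightarrow> real" where ST: "resolvent_spectrum S T w s t"
    using resolvent_spectrum_exists [OF S T supp] by blast
  have "\<exists>w s (t :: 'm \<times> 'm \<Rightarrow> real). resolvent_spectrum (S' k) (T' k) w s t" for k
  proof (rule resolvent_spectrum_exists)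
    show "pos_semidef (S' k)" "pos_semidef (T' k)"
      by (simp_all add: S'_def T'_def pos_semidef_conj S T)
    have "v \<bullet> ((K k ** R ** adjoint_mat (K k)) *v v) =
        (adjoint_mat (K k) *v v) \<bullet> (R *v (adjoint_mat (K k) *v v))" for v and R :: "complex^'n^'n"
      by (simp add: inner_matrix_vector_mult flip: matrix_vector_mul_assoc)
    then show "v \<bullet> (S' k *v v) = 0" if "v \<bullet> (T' k *v v) = 0" for v
      using that by (simp add: S'_def T'_def supp)
  qed
  then obtain w' s' and t' :: "'k \<Rightarrow> 'm \<times> 'm \<Rightarrow> real"
    where ST': "\<And>k. resolvent_spectrum (S' k) (T' k) (w' k) (s' k) (t' k)"
    by metis
  have sum_pairs: "(\<Sum>b\<in>I \<times> UNIV. F (fst b) (snd b)) = (\<Sum>k\<in>I. \<Sum>a\<in>UNIV. F k a)"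
    for F :: "'k \<Rightarrow> 'm \<times> 'm \<Rightarrow> real"
    by (simp add: sum.cartesian_product case_prod_beta)
  have entropy: "rel_entropy P Q = (\<Sum>a\<in>UNIV. w a * s a * (ln (s a) - ln (t a)))"
    if "resolvent_spectrum P Q w s t" for P Q :: "complex^'a^'a" and w s and t :: "'b::finite \<Rightarrow> real"
  proof -
    have "rel_entropy (1 *\<^sub>R P) (1 *\<^sub>R Q) = 1 * (\<Sum>a\<in>UNIV. w a * s a * (ln (s a) - ln (t a)))"
      using that zero_less_one unfolding resolvent_spectrum_def by blast
    then show ?thesis
      by simp
  qed
  have "(\<Sum>b\<in>I \<times> UNIV. w' (fst b) (snd b) * s' (fst b) (snd b) * (ln (s' (fst b) (snd b)) - ln (t' (fst b) (snd b))))
      \<le> (\<Sum>a\<in>UNIV. w a * s a * (ln (s a) - ln (t a)))"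
  proof (rule entropy_sum_mono)
    show "0 \<le> s a" "0 \<le> t a" "t a = 0 \<Longrightarrow> w a * s a = 0" for a
      using ST unfolding resolvent_spectrum_def by blast+
    show "0 \<le> s' (fst b) (snd b)" "0 \<le> t' (fst b) (snd b)"
      "t' (fst b) (snd b) = 0 \<Longrightarrow> w' (fst b) (snd b) * s' (fst b) (snd b) = 0" for b
      using ST' [of "fst b"] unfolding resolvent_spectrum_def by blast+
    have trace_S': "Re (trace (S' k)) = (\<Sum>a\<in>UNIV. w' k a * s' k a)" for k
      using ST' [of k] unfolding resolvent_spectrum_def by blast
    have "(\<Sum>b\<in>I \<times> UNIV. w' (fst b) (snd b) * s' (fst b) (snd b)) = (\<Sum>k\<in>I. Re (trace (S' k)))"
      unfolding trace_S' by (rule sum_pairs)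
    also have "\<dots> = (\<Sum>a\<in>UNIV. w a * s a)"
      using ST unfolding resolvent_spectrum_def by (simp add: S'_def trace_conj_sum [OF K])
    finally show "(\<Sum>b\<in>I \<times> UNIV. w' (fst b) (snd b) * s' (fst b) (snd b)) = (\<Sum>a\<in>UNIV. w a * s a)" .
    fix x :: real
    assume x: "0 \<le> x"
    have "\<exists>Z. resolvent_form x (S' k) (T' k) Z = (\<Sum>a\<in>UNIV. w' k a * (s' k a)\<^sup>2 / (t' k a + x * s' k a))" for k
      using ST' [of k] x unfolding resolvent_spectrum_def by blast
    then obtain Z where Z: "\<And>k. resolvent_form x (S' k) (T' k) (Z k) = (\<Sum>a\<in>UNIV. w' k a * (s' k a)\<^sup>2 / (t' k a + x * s' k a))"
      by metis
    have "(\<Sum>b\<in>I \<times> UNIV. w' (fst b) (snd b) * (s' (fst b) (snd b))\<^sup>2 / (t' (fst b) (snd b) + x * s' (fst b) (snd b)))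
        = (\<Sum>k\<in>I. resolvent_form x (S' k) (T' k) (Z k))"
      unfolding Z by (rule sum_pairs)
    also have "\<dots> \<le> resolvent_form x S T (\<Sum>k\<in>I. adjoint_mat (K k) ** Z k ** K k)"
      unfolding S'_def T'_def by (rule resolvent_form_instrument_le [OF S T K x])
    also have "\<dots> \<le> (\<Sum>a\<in>UNIV. w a * (s a)\<^sup>2 / (t a + x * s a))"
      using ST x unfolding resolvent_spectrum_def by blast
    finally show "(\<Sum>b\<in>I \<times> UNIV. w' (fst b) (snd b) * (s' (fst b) (snd b))\<^sup>2 / (t' (fst b) (snd b) + x * s' (fst b) (snd b)))
        \<le> (\<Sum>a\<in>UNIV. w a * (s a)\<^sup>2 / (t a + x * s a))" .
  qed
  also have "\<dots> = rel_entropy S T"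
    by (rule entropy [OF ST, symmetric])
  also have "(\<Sum>b\<in>I \<times> UNIV. w' (fst b) (snd b) * s' (fst b) (snd b) * (ln (s' (fst b) (snd b)) - ln (t' (fst b) (snd b))))
      = (\<Sum>k\<in>I. rel_entropy (S' k) (T' k))"
    unfolding entropy [OF ST'] by (rule sum_pairs)
  finally show ?thesis
    by (simp add: S'_def T'_def)
qed

lemma rel_entropy_scaleR:
  fixes S T :: "complex^'n^'n"
  assumes "pos_semidef S" "pos_semidef T" "\<And>v. v \<bullet> (T *v v) = 0 \<Longrightarrow> v \<bullet> (S *v v) = 0" "0 < c"
  shows "rel_entropy (c *\<^sub>R S) (c *\<^sub>R T) = c * rel_entropy S T"
proof -
  obtain w s and t :: "'n \<times> 'n \<Rightarrow> real" where "resolvent_spectrum S T w s t"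
    using resolvent_spectrum_exists [of S T] assms by blast
  then have eq: "rel_entropy (c *\<^sub>R S) (c *\<^sub>R T) = c * (\<Sum>a\<in>UNIV. w a * s a * (ln (s a) - ln (t a)))"
    if "0 < c" for c
    using that unfolding resolvent_spectrum_def by blast
  show ?thesis
    using eq [of 1] eq [OF \<open>0 < c\<close>] by simp
qed

section \<open>Averaging the input of a covariant pair of channels\<close>

lemma sum_prod_UNIV: "(\<Sum>a\<in>UNIV. F a) = (\<Sum>i\<in>UNIV. \<Sum>j\<in>UNIV. F (i, j))"
  for F :: "'a::finite \<times> 'b::finite \<Rightarrow> _::comm_monoid_add"
  by (simp add: sum.cartesian_product flip: UNIV_Times_UNIV)

lemma kron_mult: "kron A B ** kron C D = kron (A ** C) (B ** D)"
proof -
  have "(kron A B ** kron C D) $ r $ c = kron (A ** C) (B ** D) $ r $ c" for r c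
    by (simp add: kron_def matrix_matrix_mult_def sum_prod_UNIV sum_product mult_ac)
  then show ?thesis
    by (simp add: vec_eq_iff)
qed

lemma adjoint_kron: "adjoint_mat (kron A B) = kron (adjoint_mat A) (adjoint_mat B)"
  by (simp add: vec_eq_iff kron_def)

lemma kron_1 [simp]: "kron (mat 1) (mat 1) = mat 1"
  by (auto simp: vec_eq_iff kron_def mat_def)

lemma kron_add_left: "kron (A + B) C = kron A C + kron B C"
  by (simp add: vec_eq_iff kron_def distrib_right)

lemma kron_scaleR_left: "kron (c *\<^sub>R A) B = c *\<^sub>R kron A B"
  by (simp add: vec_eq_iff kron_def)

section \<open>Matrix square roots and sandwiched Choi matrices\<close>

lemma sqrt_mat_conj:
  assumes "adjoint_mat A = A" "unitary_mat V"
  shows "sqrt_mat (V ** A ** adjoint_mat V) = V ** sqrt_mat A ** adjoint_mat V"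
proof -
  obtain U d where U: "unitary_mat U" and A: "A = U ** real_diag d ** adjoint_mat U"
    using hermitian_diagonalization [OF assms(1)] by blast
  have VU: "unitary_mat (V ** U)"
    by (rule unitary_mat_mult [OF assms(2) U])
  have conj: "V ** (U ** D ** adjoint_mat U) ** adjoint_mat V = (V ** U) ** D ** adjoint_mat (V ** U)" for D
    by (simp add: adjoint_mat_mult matrix_mul_assoc)
  show ?thesis
    unfolding A sqrt_mat_def conj herm_fun_eq [OF U] herm_fun_eq [OF VU] ..
qed

lemma sqrt_mat_square:
  assumes "pos_semidef A"
  shows "sqrt_mat A ** sqrt_mat A = A"
proof -
  obtain U d where U: "unitary_mat U" and A: "A = U ** real_diag d ** adjoint_mat U" and d: "\<And>i. 0 \<le> d i"
    using pos_semidef_diagonalization [OF assms] by blast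
  have sqrt_A: "sqrt_mat A = U ** real_diag (\<lambda>i. sqrt (d i)) ** adjoint_mat U"
    unfolding A sqrt_mat_def herm_fun_eq [OF U] ..
  have "(real_diag (\<lambda>i. sqrt (d i)) ** real_diag (\<lambda>i. sqrt (d i))) $ i $ j = real_diag d $ i $ j" for i j :: 'a
    unfolding matrix_mult_real_diag_right
    using d by (simp add: real_diag_def flip: of_real_mult)
  then have "real_diag (\<lambda>i. sqrt (d i)) ** real_diag (\<lambda>i. sqrt (d i)) = (real_diag d :: complex^'a^'a)"
    by (simp add: vec_eq_iff)
  moreover have "sqrt_mat A ** sqrt_mat A =
    U ** real_diag (\<lambda>i. sqrt (d i)) ** (adjoint_mat U ** U) ** real_diag (\<lambda>i. sqrt (d i)) ** adjoint_mat U"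
    unfolding sqrt_A by (simp only: matrix_mul_assoc)
  ultimately show ?thesis
    using U A by (simp add: unitary_mat_def flip: matrix_mul_assoc [of U])
qed

lemma adjoint_sqrt_mat:
  assumes "adjoint_mat A = A"
  shows "adjoint_mat (sqrt_mat A) = sqrt_mat A"
proof -
  obtain U d where U: "unitary_mat U" and A: "A = U ** real_diag d ** adjoint_mat U"
    using hermitian_diagonalization [OF assms] by blast
  show ?thesis
    unfolding A sqrt_mat_def herm_fun_eq [OF U] by (simp add: adjoint_mat_mult matrix_mul_assoc)
qed

lemma adjoint_kron_sqrt_mat:
  assumes "pos_semidef \<rho>"
  shows "adjoint_mat (kron (sqrt_mat \<rho>) (mat 1)) = kron (sqrt_mat \<rho>) (mat 1)"
  using assms by (simp add: adjoint_kron adjoint_sqrt_mat pos_semidef_altdef)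

lemma pos_semidef_choi_sandwich:
  assumes "pos_semidef \<rho>" "pos_semidef (choi N)"
  shows "pos_semidef (choi_sandwich N \<rho>)"
  using pos_semidef_conj [OF assms(2), of "kron (sqrt_mat \<rho>) (mat 1)"]
  by (simp add: choi_sandwich_def adjoint_kron_sqrt_mat assms(1))

text \<open>Definiteness in the middle forces a null vector of the second sandwich to be annihilated
  by the outer factor \<open>P\<close>, which both sandwiches share.\<close>

lemma choi_sandwich_support:
  assumes \<rho>: "pos_semidef \<rho>" and pd: "\<And>v. v \<bullet> (choi N\<^sub>2 *v v) = 0 \<Longrightarrow> v = 0"
    and v: "v \<bullet> (choi_sandwich N\<^sub>2 \<rho> *v v) = 0"
  shows "v \<bullet> (choi_sandwich N\<^sub>1 \<rho> *v v) = 0"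
proof -
  define P where "P = kron (sqrt_mat \<rho>) (mat 1 :: complex^'b^'b)"
  have form: "v \<bullet> (choi_sandwich N \<rho> *v v) = (P *v v) \<bullet> (choi N *v (P *v v))" for N
    unfolding choi_sandwich_def P_def [symmetric]
    using adjoint_kron_sqrt_mat [OF \<rho>, where 'b = 'b]
    by (simp add: inner_matrix_vector_mult P_def flip: matrix_vector_mul_assoc)
  then show ?thesis
    using v pd by (metis form inner_zero_left)
qed

text \<open>
  With \<open>\<tau> = (\<rho> + H \<rho> H) / 2\<close> and \<open>C = \<surd>\<rho> \<tau>\<^sup>-\<^sup>1\<^sup>/\<^sup>2\<close>, the operators \<open>C / \<surd>2\<close> and \<open>C H / \<surd>2\<close> form a
  measurement both of whose outcomes turn the state at \<open>\<tau>\<close> into half the state at \<open>\<rho>\<close>.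
\<close>

lemma rel_entropy_choi_average:
  fixes N\<^sub>1 N\<^sub>2 :: "complex^'a^'a \<Rightarrow> complex^'b^'b"
  assumes psd: "pos_semidef (choi N\<^sub>1)" "pos_semidef (choi N\<^sub>2)"
    and pd: "\<And>v. v \<bullet> (choi N\<^sub>2 *v v) = 0 \<Longrightarrow> v = 0"
    and H: "adjoint_mat H = H" "H ** H = mat 1" and G: "adjoint_mat G = G" "G ** G = mat 1"
    and cov: "kron H G ** choi N\<^sub>1 = choi N\<^sub>1 ** kron H G" "kron H G ** choi N\<^sub>2 = choi N\<^sub>2 ** kron H G"
    and \<rho>: "pos_semidef \<rho>" and \<tau>: "\<tau> = (1 / 2) *\<^sub>R (\<rho> + H ** \<rho> ** H)" and inv: "\<tau> ** Q = mat 1"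
  shows "rel_entropy (choi_sandwich N\<^sub>1 \<rho>) (choi_sandwich N\<^sub>2 \<rho>)
    \<le> rel_entropy (choi_sandwich N\<^sub>1 \<tau>) (choi_sandwich N\<^sub>2 \<tau>)"
proof -
  have psd_\<tau>: "pos_semidef \<tau>"
    unfolding \<tau> using pos_semidef_conj [OF \<rho>, of H]
    by (intro pos_semidef_scaleR pos_semidef_add \<rho>) (simp_all add: H)
  have H_unitary: "unitary_mat H"
    by (simp add: unitary_mat_def H)
  define R where "R = sqrt_mat \<tau>"
  \<comment> \<open>This is the inverse square root of \<tau>: R R Q = \<tau> Q = 1.\<close>
  define R' where "R' = R ** Q"
  have RR: "R ** R = \<tau>"
    unfolding R_def by (rule sqrt_mat_square [OF psd_\<tau>])
  have adj_R: "adjoint_mat R = R"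
    using psd_\<tau> by (simp add: R_def adjoint_sqrt_mat pos_semidef_altdef)
  have "H ** \<tau> ** H = (1 / 2) *\<^sub>R (H ** \<rho> ** H + (H ** H) ** \<rho> ** (H ** H))"
    unfolding \<tau> by (simp add: matrix_mult_scaleR_left matrix_mult_scaleR_right matrix_add_ldistrib
        matrix_mult_add_left matrix_mul_assoc)
  then have "H ** \<tau> ** H = \<tau>"
    by (simp add: H \<tau> add.commute)
  then have HRH: "H ** R ** H = R"
    using sqrt_mat_conj [OF _ H_unitary, of \<tau>] psd_\<tau> by (simp add: R_def H pos_semidef_altdef)
  then have HR: "H ** R = R ** H"
    by (metis H(2) matrix_mul_assoc matrix_mul_rid)
  have RR': "R ** R' = mat 1"
    by (simp add: R'_def matrix_mul_assoc RR inv)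
  then have R'R: "R' ** R = mat 1"
    by (simp add: matrix_left_right_inverse)
  have R'_unique: "X = R'" if "X ** R = mat 1" for X
    using that by (metis RR' matrix_mul_assoc matrix_mul_lid matrix_mul_rid)
  have adj_R': "adjoint_mat R' = R'"
    using RR' adj_R by (intro R'_unique) (metis adjoint_mat_1 adjoint_mat_mult)
  have "(H ** R' ** H) ** R = H ** R' ** (H ** R)"
    by (simp only: matrix_mul_assoc)
  also have "\<dots> = H ** (R' ** R) ** H"
    unfolding HR by (simp only: matrix_mul_assoc)
  finally have "H ** R' ** H = R'"
    by (intro R'_unique) (simp add: R'R H)
  then have HR': "H ** R' = R' ** H"
    by (metis H(2) matrix_mul_assoc matrix_mul_rid)
  define C where "C = sqrt_mat \<rho> ** R'"
  have adj_C: "adjoint_mat C = R' ** sqrt_mat \<rho>"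
    using \<rho> by (simp add: C_def adjoint_mat_mult adj_R' adjoint_sqrt_mat pos_semidef_altdef)
  have "C ** R = sqrt_mat \<rho> ** (R' ** R)" "R ** adjoint_mat C = (R ** R') ** sqrt_mat \<rho>"
    unfolding adj_C by (simp_all add: C_def matrix_mul_assoc)
  then have CR: "C ** R = sqrt_mat \<rho>" "R ** adjoint_mat C = sqrt_mat \<rho>"
    by (simp_all add: R'R RR')
  have "adjoint_mat C ** C = R' ** (sqrt_mat \<rho> ** sqrt_mat \<rho>) ** R'"
    unfolding adj_C by (simp add: C_def matrix_mul_assoc)
  then have CC: "adjoint_mat C ** C = R' ** \<rho> ** R'"
    by (simp add: sqrt_mat_square \<rho>)
  define V where "V = kron H G"
  have adj_V: "adjoint_mat V = V"
    by (simp add: V_def adjoint_kron H G)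
  define L where "L = kron C (mat 1 :: complex^'b^'b)"
  \<comment> \<open>The second outcome also applies \<open>G\<close> on the output side, since it is
    the product of H and G that commutes with the Choi matrices.\<close>
  define K where "K b = (1 / sqrt 2) *\<^sub>R (if b then L ** V else L)" for b
  have "(\<Sum>b\<in>UNIV. adjoint_mat (K b) ** K b) = (1 / 2) *\<^sub>R (V ** (adjoint_mat L ** L) ** V + adjoint_mat L ** L)"
    by (simp add: UNIV_bool K_def adjoint_mat_scaleR matrix_mult_scaleR_left matrix_mult_scaleR_right
        adjoint_mat_mult adj_V matrix_mul_assoc scaleR_add_right add.commute)
  also have "adjoint_mat L ** L = kron (R' ** \<rho> ** R') (mat 1)"
    by (simp add: L_def adjoint_kron kron_mult CC)
  also have "V ** \<dots> ** V = kron (H ** (R' ** \<rho> ** R') ** H) (mat 1)"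
    by (simp add: V_def kron_mult G)
  also have "H ** (R' ** \<rho> ** R') ** H = (H ** R') ** \<rho> ** (R' ** H)"
    by (simp only: matrix_mul_assoc)
  also have "\<dots> = R' ** (H ** \<rho> ** H) ** R'"
    unfolding HR' by (simp add: HR' flip: matrix_mul_assoc)
  also have "(1 / 2) *\<^sub>R (kron (R' ** (H ** \<rho> ** H) ** R') (mat 1 :: complex^'b^'b) + kron (R' ** \<rho> ** R') (mat 1)) =
      kron (R' ** \<tau> ** R') (mat 1)"
    by (simp add: \<tau> matrix_mult_scaleR_left matrix_mult_scaleR_right kron_scaleR_left
        matrix_add_ldistrib matrix_mult_add_left kron_add_left add.commute)
  also have "R' ** \<tau> ** R' = (R' ** R) ** (R ** R')"
    by (simp flip: RR add: matrix_mul_assoc)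
  finally have K_sum: "(\<Sum>b\<in>UNIV. adjoint_mat (K b) ** K b) = mat 1"
    by (simp add: R'R RR')
  \<comment> \<open>\<open>V\<close> commutes with the square root of \<tau> and with the Choi
    matrix, so it cancels against itself and both outcomes agree. The factor \<open>C\<close> then
    replaces the square root of \<tau> by that of \<rho>.\<close>
  have outcome: "K b ** choi_sandwich N \<tau> ** adjoint_mat (K b) = (1 / 2) *\<^sub>R choi_sandwich N \<rho>"
    if cov: "V ** choi N = choi N ** V" for b and N :: "complex^'a^'a \<Rightarrow> complex^'b^'b"
  proof -
    define P where "P = kron R (mat 1 :: complex^'b^'b)"
    have VP: "V ** P = P ** V"
      by (simp add: V_def P_def kron_mult HR)
    have VV: "V ** V = mat 1"
      by (simp add: V_def kron_mult H G)
    have "V ** (P ** choi N ** P) ** V = (V ** P) ** choi N ** P ** V"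
      by (simp only: matrix_mul_assoc)
    also have "\<dots> = P ** (V ** choi N) ** P ** V"
      unfolding VP by (simp only: matrix_mul_assoc)
    also have "\<dots> = P ** choi N ** (V ** P) ** V"
      unfolding cov by (simp only: matrix_mul_assoc)
    also have "\<dots> = P ** choi N ** P ** (V ** V)"
      unfolding VP by (simp only: matrix_mul_assoc)
    finally have VMV: "V ** (P ** choi N ** P) ** V = P ** choi N ** P"
      by (simp add: VV)
    have "L ** V ** (P ** choi N ** P) ** (V ** adjoint_mat L) = L ** (V ** (P ** choi N ** P) ** V) ** adjoint_mat L"
      by (simp only: matrix_mul_assoc)
    then have "L ** V ** (P ** choi N ** P) ** (V ** adjoint_mat L) = L ** (P ** choi N ** P) ** adjoint_mat L"
      unfolding VMV .
    then have "K b ** choi_sandwich N \<tau> ** adjoint_mat (K b) =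
        (1 / 2) *\<^sub>R (L ** (P ** choi N ** P) ** adjoint_mat L)"
      by (simp add: K_def choi_sandwich_def P_def R_def adjoint_mat_scaleR matrix_mult_scaleR_left
          matrix_mult_scaleR_right adjoint_mat_mult adj_V)
    also have "L ** (P ** choi N ** P) ** adjoint_mat L = (L ** P) ** choi N ** (P ** adjoint_mat L)"
      by (simp only: matrix_mul_assoc)
    also have "\<dots> = choi_sandwich N \<rho>"
      by (simp add: L_def P_def adjoint_kron kron_mult CR choi_sandwich_def)
    finally show ?thesis .
  qed
  have "(\<Sum>b\<in>UNIV. rel_entropy (K b ** choi_sandwich N\<^sub>1 \<tau> ** adjoint_mat (K b)) (K b ** choi_sandwich N\<^sub>2 \<tau> ** adjoint_mat (K b)))
      \<le> rel_entropy (choi_sandwich N\<^sub>1 \<tau>) (choi_sandwich N\<^sub>2 \<tau>)"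
    by (rule rel_entropy_instrument_le [OF pos_semidef_choi_sandwich [OF psd_\<tau> psd(1)]
          pos_semidef_choi_sandwich [OF psd_\<tau> psd(2)] choi_sandwich_support [OF psd_\<tau> pd] K_sum])
  \<comment> \<open>By homogeneity the two equal outcomes of weight 1/2 add up to the full entropy
    at \<rho>.\<close>
  moreover have "rel_entropy ((1 / 2) *\<^sub>R choi_sandwich N\<^sub>1 \<rho>) ((1 / 2) *\<^sub>R choi_sandwich N\<^sub>2 \<rho>) =
      (1 / 2) * rel_entropy (choi_sandwich N\<^sub>1 \<rho>) (choi_sandwich N\<^sub>2 \<rho>)"
    by (rule rel_entropy_scaleR [OF pos_semidef_choi_sandwich [OF \<rho> psd(1)]
          pos_semidef_choi_sandwich [OF \<rho> psd(2)] choi_sandwich_support [OF \<rho> pd]]) auto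
  ultimately show ?thesis
    using cov by (simp add: outcome V_def UNIV_bool)
qed

section \<open>Pauli covariance of the two qubit channels\<close>

lemma choi_nth: "choi N $ r $ c = N (mat_unit (fst r) (fst c)) $ snd r $ snd c"
proof -
  have "choi N $ r $ c = (\<Sum>i\<in>UNIV. \<Sum>j\<in>UNIV. mat_unit i j $ fst r $ fst c * N (mat_unit i j) $ snd r $ snd c)"
    by (simp add: choi_def kron_def)
  also have "\<dots> = (\<Sum>i\<in>UNIV. if i = fst r then N (mat_unit (fst r) (fst c)) $ snd r $ snd c else 0)"
  proof (intro sum.cong refl)
    fix i
    have "(\<Sum>j\<in>UNIV. mat_unit i j $ fst r $ fst c * N (mat_unit i j) $ snd r $ snd c) =
        (\<Sum>j\<in>UNIV. if j = fst c then (if i = fst r then N (mat_unit (fst r) (fst c)) $ snd r $ snd c else 0) else 0)"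
      by (intro sum.cong refl) (auto simp: mat_unit_def)
    then show "(\<Sum>j\<in>UNIV. mat_unit i j $ fst r $ fst c * N (mat_unit i j) $ snd r $ snd c) =
        (if i = fst r then N (mat_unit (fst r) (fst c)) $ snd r $ snd c else 0)"
      by simp
  qed
  finally show ?thesis
    by simp
qed

lemma choi_dephasing_nth:
  "choi (dephasing q) $ (i, k) $ (j, l) =
    (if i = k \<and> j = l then if i = j then 1 else of_real (2 * q - 1) else 0)"
  using exhaust_2 [of i] exhaust_2 [of j] exhaust_2 [of k] exhaust_2 [of l]
  by (auto simp: choi_nth dephasing_def mat_unit_def matrix_matrix_mult_def sum_2 sigma_z_def
      scaleR_conv_of_real [where 'a = complex])

lemma choi_depolarizing_nth:
  "choi (depolarizing p) $ (i, k) $ (j, l) =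
    of_real ((if i = k \<and> j = l then 1 - p else 0) + (if i = j \<and> k = l then p / 2 else 0))"
  using exhaust_2 [of i] exhaust_2 [of j] exhaust_2 [of k] exhaust_2 [of l]
  by (auto simp: choi_nth depolarizing_def mat_unit_def mat_def trace_def sum_2
      scaleR_conv_of_real [where 'a = complex])

lemma quadratic_form_qubit_pair:
  fixes A :: "complex^(2 \<times> 2)^(2 \<times> 2)"
  shows "v \<bullet> (A *v v) = (\<Sum>i\<in>UNIV. \<Sum>k\<in>UNIV. \<Sum>j\<in>UNIV. \<Sum>l\<in>UNIV. v $ (i, k) \<bullet> (A $ (i, k) $ (j, l) * v $ (j, l)))"
  by (simp add: inner_vec_def matrix_vector_mult_def sum_prod_UNIV inner_sum_right)

lemma pos_semidef_choi_dephasing: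
  assumes "0 \<le> q" "q \<le> 1"
  shows "pos_semidef (choi (dephasing q))"
proof -
  \<comment> \<open>The Choi matrix mixes the unnormalised Bell vectors |00> + |11> and |00> - |11>
    with weights q and 1 - q.\<close>
  have "v \<bullet> (choi (dephasing q) *v v) =
    q * (cmod (v $ (1, 1) + v $ (2, 2)))\<^sup>2 + (1 - q) * (cmod (v $ (1, 1) - v $ (2, 2)))\<^sup>2" for v
    by (simp add: quadratic_form_qubit_pair choi_dephasing_nth sum_2 inner_complex_def cmod_power2)
      (simp add: power2_eq_square algebra_simps)
  moreover have "adjoint_mat (choi (dephasing q)) = choi (dephasing q)"
    by (auto simp: vec_eq_iff choi_dephasing_nth)
  ultimately show ?thesis
    using assms by (simp add: pos_semidef_altdef)
qed

text \<open>The Choi matrix is 1 - p times the rank-one operator of |00> + |11>, plus p / 2 times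
  the identity; for 0 < p \<le> 1 the identity part makes it definite.\<close>

lemma quadratic_form_choi_depolarizing:
  "v \<bullet> (choi (depolarizing p) *v v) = (1 - p) * (cmod (v $ (1, 1) + v $ (2, 2)))\<^sup>2 + p / 2 * (v \<bullet> v)"
  by (simp add: quadratic_form_qubit_pair choi_depolarizing_nth sum_2 inner_complex_def cmod_power2
      inner_vec_def [of v v] sum_prod_UNIV)
    (simp add: power2_eq_square algebra_simps add_divide_distrib)

lemma pos_semidef_choi_depolarizing:
  assumes "0 \<le> p" "p \<le> 1"
  shows "pos_semidef (choi (depolarizing p))"
proof -
  have "adjoint_mat (choi (depolarizing p)) = choi (depolarizing p)"
    by (auto simp: vec_eq_iff choi_depolarizing_nth)
  then show ?thesis
    using assms by (simp add: pos_semidef_altdef quadratic_form_choi_depolarizing)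
qed

lemma choi_depolarizing_definite:
  assumes "0 < p" "p \<le> 1" "v \<bullet> (choi (depolarizing p) *v v) = 0"
  shows "v = 0"
proof -
  have "0 \<le> (1 - p) * (cmod (v $ (1, 1) + v $ (2, 2)))\<^sup>2"
    using assms by simp
  with assms(3) have "p / 2 * (v \<bullet> v) \<le> 0"
    unfolding quadratic_form_choi_depolarizing by linarith
  with assms(1) have "v \<bullet> v \<le> 0"
    by (simp add: mult_le_0_iff)
  then show ?thesis
    by (metis inner_eq_zero_iff inner_ge_zero order_antisym)
qed

section \<open>Pauli matrices, twirling and expectation values\<close>

lemmas pauli_defs = sigma_x_def sigma_y_def sigma_z_def

lemma pauli_hermitian: "H \<in> {sigma_x, sigma_y, sigma_z} \<Longrightarrow> adjoint_mat H = H"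
  by (auto simp: vec_eq_iff forall_2 pauli_defs)

lemma pauli_square: "H \<in> {sigma_x, sigma_y, sigma_z} \<Longrightarrow> H ** H = mat 1"
  by (auto simp: vec_eq_iff forall_2 pauli_defs matrix_matrix_mult_def sum_2 mat_def)

lemma pauli_trace: "H \<in> {sigma_x, sigma_y, sigma_z} \<Longrightarrow> trace H = 0"
  by (auto simp: pauli_defs trace_def sum_2)

text \<open>In Bloch form, conjugation by H flips the two Pauli components that anticommute with H
  and fixes the other terms. Only the identity and the component along H survive, and the latter is
  the prescribed E.\<close>

lemma pauli_twirl:
  assumes "H \<in> {sigma_x, sigma_y, sigma_z}" "trace \<rho> = 1" "trace (\<rho> ** H) = complex_of_real E"
  shows "\<rho> + H ** \<rho> ** H = mat 1 + E *\<^sub>R H"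
proof -
  have tr: "\<rho> $ 1 $ 1 + \<rho> $ 2 $ 2 = 1"
    using assms(2) by (simp add: trace_def sum_2)
  have "\<rho> + H ** \<rho> ** H = mat (\<rho> $ 1 $ 1 + \<rho> $ 2 $ 2) + (\<chi> i j. trace (\<rho> ** H) * H $ i $ j)"
    using assms(1)
    by (auto simp: vec_eq_iff forall_2 pauli_defs trace_def matrix_matrix_mult_def sum_2 mat_def algebra_simps)
  then show ?thesis
    unfolding tr assms(3) by (simp add: vec_eq_iff scaleR_conv_of_real [where 'a = complex])
qed

text \<open>Covariance of a channel under H becomes commutation of its Choi matrix with the product
  of the entrywise conjugate of H and H. That conjugate is H up to sign, and the sign drops out of a
  commutation relation.\<close>

lemma dephasing_pauli_covariant:
  assumes "H \<in> {sigma_x, sigma_y, sigma_z}"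
  shows "kron H H ** choi (dephasing q) = choi (dephasing q) ** kron H H"
  using assms
  by (auto simp: vec_eq_iff forall_2 matrix_matrix_mult_def sum_prod_UNIV sum_2 choi_dephasing_nth
      kron_def pauli_defs)

lemma depolarizing_pauli_covariant:
  assumes "H \<in> {sigma_x, sigma_y, sigma_z}"
  shows "kron H H ** choi (depolarizing p) = choi (depolarizing p) ** kron H H"
proof -
  \<comment> \<open>\<open>dephasing 1\<close> is the identity channel, so the covariance already
    proved carries over.\<close>
  have "choi (depolarizing p) = (1 - p) *\<^sub>R choi (dephasing 1) + (p / 2) *\<^sub>R mat 1"
    by (auto simp: vec_eq_iff choi_dephasing_nth choi_depolarizing_nth mat_def
        scaleR_conv_of_real [where 'a = complex])
  then show ?thesis
    by (simp add: matrix_add_ldistrib matrix_mult_add_left matrix_mult_scaleR_left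
        matrix_mult_scaleR_right dephasing_pauli_covariant [OF assms])
qed

text \<open>
  For \<open>s = \<plusminus>1\<close> the matrix \<open>P = 1 - s H\<close> is twice a projector, so
  \<open>2 (1 - s E) = 2 Tr \<rho> P = Tr P \<rho> P \<ge> 0\<close>.
\<close>

lemma pauli_expectation_bound:
  assumes H: "adjoint_mat H = H" "H ** H = mat 1" and \<rho>: "pos_semidef \<rho>" "trace \<rho> = 1"
    and E: "trace (\<rho> ** H) = complex_of_real E" and s: "s\<^sup>2 = 1"
  shows "(mat 1 - s *\<^sub>R H) \<bullet> (\<rho> ** (mat 1 - s *\<^sub>R H)) = 2 * (1 - s * E)" and "s * E \<le> 1"
proof -
  define P where "P = mat 1 - s *\<^sub>R H"
  have "P ** adjoint_mat P = P - (s *\<^sub>R H - (s * s) *\<^sub>R (H ** H))"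
    by (simp add: P_def adjoint_mat_diff adjoint_mat_scaleR matrix_mult_diff_left matrix_mult_diff_right
        matrix_mult_scaleR_left matrix_mult_scaleR_right H(1) scaleR_diff_right)
  also have "\<dots> = P + P"
    using s by (simp only: power2_eq_square H(2) P_def scaleR_one) simp
  finally have PP: "P ** adjoint_mat P = 2 *\<^sub>R P"
    unfolding scaleR_2 .
  have "P \<bullet> (\<rho> ** P) = \<rho> \<bullet> (P ** adjoint_mat P)"
    by (subst inner_commute) (rule inner_matrix_mult_right)
  also have "\<dots> = 2 * Re (trace (\<rho> ** P))"
    using \<rho>(1) by (simp add: PP trace_mult_eq_inner pos_semidef_altdef)
  also have "Re (trace (\<rho> ** P)) = Re (trace \<rho>) - s * Re (trace (\<rho> ** H))"
    by (simp add: P_def trace_def matrix_mult_diff_right matrix_mult_scaleR_right sum_subtractf sum_distrib_left)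
  finally show eq: "(mat 1 - s *\<^sub>R H) \<bullet> (\<rho> ** (mat 1 - s *\<^sub>R H)) = 2 * (1 - s * E)"
    using \<rho>(2) E by (simp add: P_def)
  show "s * E \<le> 1"
    using pos_semidef_matrix_form [OF \<rho>(1), of P] eq by (simp add: P_def)
qed

text \<open>For s = E the expectation bound is an equality, so the squared norm of
  \<open>sqrt_mat \<rho> ** P\<close> vanishes. Hence \<rho> H = E \<rho>: the state is supported on
  an eigenspace of H.\<close>

lemma pauli_extreme_commute:
  assumes H: "adjoint_mat H = H" "H ** H = mat 1" and \<rho>: "pos_semidef \<rho>" "trace \<rho> = 1"
    and E: "trace (\<rho> ** H) = complex_of_real E" "E\<^sup>2 = 1"
  shows "H ** \<rho> ** H = \<rho>"
proof -
  define P where "P = mat 1 - E *\<^sub>R H"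
  have adj_\<rho>: "adjoint_mat \<rho> = \<rho>"
    using \<rho>(1) by (simp add: pos_semidef_altdef)
  have EE: "E * E = 1"
    using E(2) by (simp add: power2_eq_square)
  have "(sqrt_mat \<rho> ** P) \<bullet> (sqrt_mat \<rho> ** P) = P \<bullet> ((sqrt_mat \<rho> ** sqrt_mat \<rho>) ** P)"
    by (simp add: inner_matrix_mult_left adjoint_sqrt_mat adj_\<rho> matrix_mul_assoc)
  also have "\<dots> = 0"
    using pauli_expectation_bound(1) [OF H \<rho> E] EE by (simp add: sqrt_mat_square \<rho>(1) P_def)
  finally have "sqrt_mat \<rho> ** P = 0"
    by simp
  then have "(sqrt_mat \<rho> ** sqrt_mat \<rho>) ** P = 0"
    by (simp flip: matrix_mul_assoc)
  then have \<rho>_eq: "\<rho> = E *\<^sub>R (\<rho> ** H)"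
    by (simp add: sqrt_mat_square \<rho>(1) P_def matrix_mult_diff_right matrix_mult_scaleR_right)
  then have "E *\<^sub>R \<rho> = \<rho> ** H"
    using EE by (metis scaleR_one scaleR_scaleR)
  moreover from this have "E *\<^sub>R \<rho> = H ** \<rho>"
    by (metis H(1) adj_\<rho> adjoint_mat_mult adjoint_mat_scaleR)
  ultimately show ?thesis
    using EE by (metis matrix_mult_scaleR_left scaleR_one scaleR_scaleR)
qed

theorem proposition19:
  fixes p q E :: real and N\<^sub>1 N\<^sub>2 :: "complex^2^2 \<Rightarrow> complex^2^2"
    and f :: "complex^2^2 \<Rightarrow> real" and H \<rho>h :: "complex^2^2"
  assumes "p = 0.05" and "q = 0.4"
    and "N\<^sub>1 = dephasing q" and "N\<^sub>2 = depolarizing p"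
    and "f = neg_channel_rel_entropy N\<^sub>1 N\<^sub>2"
    and "H \<in> {sigma_x, sigma_y, sigma_z}"
    and "feasible H E \<noteq> {}"
    and "\<rho>h = (1 / 2) *\<^sub>R (mat 1 + E *\<^sub>R H)"
  shows "is_arg_min f (\<lambda>\<rho>. \<rho> \<in> feasible H E) \<rho>h"
proof -
  note H = pauli_hermitian [OF assms(6)] pauli_square [OF assms(6)]
  have average: "\<rho>h = (1 / 2) *\<^sub>R (\<rho> + H ** \<rho> ** H)" if "\<rho> \<in> feasible H E" for \<rho>
    using that pauli_twirl [OF assms(6), of \<rho> E] by (simp add: assms(8) feasible_def density_op_def)
  obtain \<rho>0 where \<rho>0: "\<rho>0 \<in> feasible H E"
    using assms(7) by blast
  then have psd0: "pos_semidef \<rho>0"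
    by (simp add: feasible_def density_op_def)
  \<comment> \<open>Positivity is inherited from any feasible state by averaging, so nonemptiness of
    the feasible set takes the place of an eigenvalue computation.\<close>
  have "pos_semidef \<rho>h"
    unfolding average [OF \<rho>0] using pos_semidef_conj [OF psd0, of H]
    by (intro pos_semidef_scaleR pos_semidef_add psd0) (simp_all add: H)
  moreover have trace_\<rho>h: "trace (\<rho>h ** X) = (trace X + E *\<^sub>R trace (H ** X)) / 2" for X
    by (simp add: assms(8) matrix_mult_scaleR_left matrix_mult_add_left trace_def sum_2 add_divide_distrib
        scaleR_conv_of_real [where 'a = complex] algebra_simps)
  moreover have "trace \<rho>h = 1"
  proof -
    have "trace (mat 1 :: qmat) = 2"
      by (simp add: trace_def sum_2 mat_def)
    then show ?thesis
      using trace_\<rho>h [of "mat 1"] pauli_trace [OF assms(6)] by simp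
  qed
  moreover have "trace (\<rho>h ** H) = complex_of_real E"
    unfolding trace_\<rho>h using pauli_trace [OF assms(6)] H(2)
    by (simp add: trace_def sum_2 mat_def scaleR_conv_of_real [where 'a = complex])
  ultimately have "\<rho>h \<in> feasible H E"
    by (simp add: feasible_def density_op_def)
  moreover have "f \<rho>h \<le> f \<rho>" if \<rho>: "\<rho> \<in> feasible H E" for \<rho>
  proof -
    have psd: "pos_semidef \<rho>" "trace \<rho> = 1" "trace (\<rho> ** H) = complex_of_real E"
      using \<rho> by (simp_all add: feasible_def density_op_def)
    have "E \<le> 1" "- E \<le> 1"
      using pauli_expectation_bound(2) [OF H psd, of 1] pauli_expectation_bound(2) [OF H psd, of "-1"]
      by simp_all
    then have "E\<^sup>2 \<le> 1"
      by (simp add: abs_square_le_1)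
    show ?thesis
    proof (cases "E\<^sup>2 = 1")
      case True
      then have "H ** \<rho> ** H = \<rho>"
        by (rule pauli_extreme_commute [OF H psd])
      then have "\<rho>h = \<rho>"
        unfolding average [OF \<rho>] by (simp flip: scaleR_2)
      then show ?thesis
        by simp
    next
      case False
      \<comment> \<open>Since H squares to 1, (1 + E H) (1 - E H) = 1 - E^2, which gives the inverse
        of the candidate explicitly.\<close>
      define Q where "Q = (2 / (1 - E\<^sup>2)) *\<^sub>R (mat 1 - E *\<^sub>R H)"
      have "(mat 1 + E *\<^sub>R H) ** (mat 1 - E *\<^sub>R H) = (1 - E\<^sup>2) *\<^sub>R mat 1"
        by (simp add: matrix_mult_add_left matrix_mult_diff_right matrix_mult_scaleR_left
            matrix_mult_scaleR_right H power2_eq_square algebra_simps)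
      moreover have "2 / (1 - E\<^sup>2) * (1 / 2) * (1 - E\<^sup>2) = 1"
        using False by (simp add: field_simps)
      ultimately have inv: "\<rho>h ** Q = mat 1"
        unfolding assms(8) Q_def matrix_mult_scaleR_left matrix_mult_scaleR_right scaleR_scaleR
        by (simp only: scaleR_scaleR scaleR_one)
      have definite: "v = 0" if "v \<bullet> (choi (depolarizing p) *v v) = 0" for v
        using choi_depolarizing_definite [OF _ _ that] by (simp add: assms(1))
      have choi_psd: "pos_semidef (choi (dephasing q))" "pos_semidef (choi (depolarizing p))"
        by (simp_all add: pos_semidef_choi_dephasing pos_semidef_choi_depolarizing assms(1,2))
      have "rel_entropy (choi_sandwich N\<^sub>1 \<rho>) (choi_sandwich N\<^sub>2 \<rho>)
          \<le> rel_entropy (choi_sandwich N\<^sub>1 \<rho>h) (choi_sandwich N\<^sub>2 \<rho>h)"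
        unfolding assms(3,4)
        by (rule rel_entropy_choi_average [OF choi_psd definite H H
              dephasing_pauli_covariant [OF assms(6)] depolarizing_pauli_covariant [OF assms(6)]
              psd(1) average [OF \<rho>] inv])
      then show ?thesis
        by (simp add: assms(5) neg_channel_rel_entropy_def)
    qed
  qed
  ultimately show ?thesis
    by (auto simp: is_arg_min_def not_less)
qed

end
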